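(* Let $\mathsf{C}$ be a strict braided monoidal category that admits split idempotents, and let $(H,m_{H},\Phi_{H})$ be a twisted post-Hopf algebra in $\mathsf{C}$ satisfying $$(m_{H}\otimes H)\circ(H\otimes c_{H,H})\circ((c_{H,H}\circ\delta_{H})\otimes H)=(m_{H}\otimes H)\circ(H\otimes c_{H,H})\circ(\delta_{H}\otimes H).$$ Let $p_H\colon H\to I(\Phi_H)$ and $i_H\colon I(\Phi_H)\to H$ be a splitting of the idempotent $\Phi_H$, i.e. $i_H\circ p_H=\Phi_H$ and $p_H\circ i_H=\mathrm{id}_{I(\Phi_H)}$. Then $I(\Phi_{H})=(I(\Phi_{H}),\eta_{I(\Phi_{H})},\mu_{I(\Phi_{H})},\varepsilon_{I(\Phi_{H})},\delta_{I(\Phi_{H})})$ is a bialgebra in $\mathsf{C}$, where $$\mu_{I(\Phi_{H})}:= p_{H}\circ\overline{\mu}_{H}\circ(i_{H}\otimes i_{H}),\quad \eta_{I(\Phi_{H})}:= p_{H}\circ\eta_{H},\quad \delta_{I(\Phi_{H})}:=(p_{H}\otimes p_{H})\circ\delta_{H}\circ i_{H},\quad \varepsilon_{I(\Phi_{H})}:=\varepsilon_{H}\circ i_{H},$$ with $\overline{\mu}_{H}:=\mu_{H}\circ(\Phi_{H}\otimes m_{H})\circ(\delta_{H}\otimes H)$.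
   Context: $\mathsf{C}=(\mathsf{C},\otimes,K,c)$ is a strict braided monoidal category with unit object $K$ and braiding $c_{M,N}\colon M\otimes N\to N\otimes M$. For an object $X$ and a morphism $f$, $X\otimes f$ and $f\otimes X$ denote $\mathrm{id}_X\otimes f$ and $f\otimes \mathrm{id}_X$. A Hopf algebra in $\mathsf{C}$ is $H=(H,\eta_H,\mu_H,\varepsilon_H,\delta_H,\lambda_H)$ (unit, product, counit, coproduct, antipode). The tensor product $D\otimes E$ of coalgebras has coproduct $(D\otimes c_{D,E}\otimes E)\circ(\delta_D\otimes\delta_E)$ and counit $\varepsilon_D\otimes\varepsilon_E$. $\mathsf{C}$ admits split idempotents if every idempotent $q\colon X\to X$ factors as $q=i\circ p$ with $p\colon X\to I(q)$, $i\colon I(q)\to X$ and $p\circ i=\mathrm{id}_{I(q)}$. An object $H$ is finite if there are an object $H^*$ and morphisms $a_H(K)\colon K\to H^*\otimes H$, $b_H(K)\colon H\otimes H^*\to K$ (unit and counit of the adjunction $H\otimes-\dashv H^*\otimes-$) with $(b_H(K)\otimes H)\circ(H\otimes a_H(K))=\mathrm{id}_H$ and $(H^*\otimes b_H(K))\circ(a_H(K)\otimes H^* )=\mathrm{id}_{H^*}$. Weak twisted post-Hopf algebra: a triple $(H,m_H,\Phi_H)$ with $H$ a Hopf algebra in $\mathsf{C}$ and morphisms $m_H\colon H\otimes H\to H$, $\Phi_H\colon H\to H$ such that: (i) $m_H$ is a coalgebra morphism; (ii) $\Phi_H$ is a coalgebra morphism; (iii) $\Phi_{H}\circ\mu_{H}\circ(\Phi_{H}\otimes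 m_{H})\circ(\delta_{H}\otimes H)=\mu_{H}\circ(\Phi_{H}\otimes m_{H})\circ(\delta_{H}\otimes \Phi_{H})$; (iv) $m_{H}\circ(H\otimes m_{H})=m_{H}\circ((\mu_{H}\circ(\Phi_{H}\otimes m_{H})\circ(\delta_{H}\otimes H))\otimes H)$; (v) $m_{H}\circ(H\otimes\mu_{H})=\mu_{H}\circ(m_{H}\otimes m_{H})\circ(H\otimes c_{H,H}\otimes H)\circ(\delta_{H}\otimes H\otimes H)$. Twisted post-Hopf algebra: a weak twisted post-Hopf algebra with $H$ finite such that (vi) $\Phi_H\circ\eta_H=\eta_H$; (vii) $\alpha_{H}:=(H^{*}\otimes m_{H})\circ(c_{H,H^{*}}\otimes H)\circ(H\otimes a_{H}(K))\colon H\to H^*\otimes H$ is convolution invertible, i.e. there is $\beta_H\colon H\to H^*\otimes H$ with $(H^{*}\otimes b_{H}(K)\otimes H)\circ(\alpha_{H}\otimes\beta_{H})\circ\delta_{H}=\varepsilon_{H}\otimes a_{H}(K)=(H^{*}\otimes b_{H}(K)\otimes H)\circ(\beta_{H}\otimes\alpha_{H})\circ\delta_{H}$. For a twisted post-Hopf algebra the morphism $\Phi_H$ is idempotent. *)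

theory Defs
  imports Main
begin

text \<open>
  Composition, tensor product and braiding are total HOL functions, constrained by the axioms
  only on the sets \<open>Obj\<close> and \<open>Arr\<close> and, for composition, on composable pairs.
  \<open>\<odot>\<close> is the tensor product of objects, \<open>\<otimes>\<close> that of morphisms, and \<open>\<one>X\<close> is the
  identity of \<open>X\<close>; so what is usually abbreviated \<open>X \<otimes> f\<close> is written \<open>\<one>X \<otimes> f\<close>.
\<close>

record ('o, 'm) braided_data =
  Obj :: "'o set"
  Arr :: "'m set"
  Dom :: "'m \<Rightarrow> 'o"
  Cod :: "'m \<Rightarrow> 'o"
  Ident :: "'o \<Rightarrow> 'm"  ("\<one>\<index>_" [1000] 999)
  Comp :: "'m \<Rightarrow> 'm \<Rightarrow> 'm"  (infixr "\<cdot>\<index>" 65)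
  Unit :: "'o"  ("\<K>\<index>")
  TensorO :: "'o \<Rightarrow> 'o \<Rightarrow> 'o"  (infixr "\<odot>\<index>" 70)
  TensorA :: "'m \<Rightarrow> 'm \<Rightarrow> 'm"  (infixr "\<otimes>\<index>" 70)
  Braid :: "'o \<Rightarrow> 'o \<Rightarrow> 'm"  ("\<c>\<index>")

definition Hom :: "('o, 'm, 'z) braided_data_scheme \<Rightarrow> 'o \<Rightarrow> 'o \<Rightarrow> 'm set" where
  "Hom C X Y = {f \<in> Arr C. Dom C f = X \<and> Cod C f = Y}"

locale strict_braided_monoidal_category =
  fixes C :: "('o, 'm, 'z) braided_data_scheme" (structure)
  assumes Dom_Obj: "f \<in> Arr C \<Longrightarrow> Dom C f \<in> Obj C"
    and Cod_Obj: "f \<in> Arr C \<Longrightarrow> Cod C f \<in> Obj C"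
    and Ident_Hom: "X \<in> Obj C \<Longrightarrow> \<one>X \<in> Hom C X X"
    and Comp_Hom: "\<lbrakk>f \<in> Hom C X Y; g \<in> Hom C Y Z\<rbrakk> \<Longrightarrow> g \<cdot> f \<in> Hom C X Z"
    and Comp_Ident_left: "f \<in> Hom C X Y \<Longrightarrow> \<one>Y \<cdot> f = f"
    and Comp_Ident_right: "f \<in> Hom C X Y \<Longrightarrow> f \<cdot> \<one>X = f"
    and Comp_assoc: "\<lbrakk>f \<in> Hom C W X; g \<in> Hom C X Y; h \<in> Hom C Y Z\<rbrakk>
          \<Longrightarrow> (h \<cdot> g) \<cdot> f = h \<cdot> (g \<cdot> f)"
    and Unit_Obj: "\<K> \<in> Obj C"
    and TensorO_Obj: "\<lbrakk>X \<in> Obj C; Y \<in> Obj C\<rbrakk> \<Longrightarrow> X \<odot> Y \<in> Obj C"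
    and TensorA_Hom: "\<lbrakk>f \<in> Hom C X X'; g \<in> Hom C Y Y'\<rbrakk> \<Longrightarrow> f \<otimes> g \<in> Hom C (X \<odot> Y) (X' \<odot> Y')"
    and TensorA_Ident: "\<lbrakk>X \<in> Obj C; Y \<in> Obj C\<rbrakk> \<Longrightarrow> \<one>X \<otimes> \<one>Y = \<one>(X \<odot> Y)"
    and interchange: "\<lbrakk>f \<in> Hom C X X'; f' \<in> Hom C X' X''; g \<in> Hom C Y Y'; g' \<in> Hom C Y' Y''\<rbrakk>
          \<Longrightarrow> (f' \<cdot> f) \<otimes> (g' \<cdot> g) = (f' \<otimes> g') \<cdot> (f \<otimes> g)"
    and TensorO_assoc: "\<lbrakk>X \<in> Obj C; Y \<in> Obj C; Z \<in> Obj C\<rbrakk> \<Longrightarrow> (X \<odot> Y) \<odot> Z = X \<odot> (Y \<odot> Z)"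
    and TensorO_Unit_left: "X \<in> Obj C \<Longrightarrow> \<K> \<odot> X = X"
    and TensorO_Unit_right: "X \<in> Obj C \<Longrightarrow> X \<odot> \<K> = X"
    and TensorA_assoc: "\<lbrakk>f \<in> Arr C; g \<in> Arr C; h \<in> Arr C\<rbrakk> \<Longrightarrow> (f \<otimes> g) \<otimes> h = f \<otimes> (g \<otimes> h)"
    and TensorA_Unit_left: "f \<in> Arr C \<Longrightarrow> \<one>\<K> \<otimes> f = f"
    and TensorA_Unit_right: "f \<in> Arr C \<Longrightarrow> f \<otimes> \<one>\<K> = f"
    and Braid_Hom: "\<lbrakk>X \<in> Obj C; Y \<in> Obj C\<rbrakk> \<Longrightarrow> \<c> X Y \<in> Hom C (X \<odot> Y) (Y \<odot> X)"
    and Braid_iso: "\<lbrakk>X \<in> Obj C; Y \<in> Obj C\<rbrakk>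
          \<Longrightarrow> \<exists>d \<in> Hom C (Y \<odot> X) (X \<odot> Y). d \<cdot> \<c> X Y = \<one>(X \<odot> Y) \<and> \<c> X Y \<cdot> d = \<one>(Y \<odot> X)"
    and Braid_natural: "\<lbrakk>f \<in> Hom C X X'; g \<in> Hom C Y Y'\<rbrakk>
          \<Longrightarrow> (g \<otimes> f) \<cdot> \<c> X Y = \<c> X' Y' \<cdot> (f \<otimes> g)"
    and hexagon_right: "\<lbrakk>X \<in> Obj C; Y \<in> Obj C; Z \<in> Obj C\<rbrakk>
          \<Longrightarrow> \<c> X (Y \<odot> Z) = (\<one>Y \<otimes> \<c> X Z) \<cdot> (\<c> X Y \<otimes> \<one>Z)"
    and hexagon_left: "\<lbrakk>X \<in> Obj C; Y \<in> Obj C; Z \<in> Obj C\<rbrakk>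
          \<Longrightarrow> \<c> (X \<odot> Y) Z = (\<c> X Z \<otimes> \<one>Y) \<cdot> (\<one>X \<otimes> \<c> Y Z)"

definition splitting ::
  "('o, 'm, 'z) braided_data_scheme \<Rightarrow> 'o \<Rightarrow> 'm \<Rightarrow> 'o \<Rightarrow> 'm \<Rightarrow> 'm \<Rightarrow> bool" where
  "splitting C X q Y p i \<longleftrightarrow>
     p \<in> Hom C X Y \<and> i \<in> Hom C Y X \<and> i \<cdot>\<^bsub>C\<^esub> p = q \<and> p \<cdot>\<^bsub>C\<^esub> i = \<one>\<^bsub>C\<^esub>Y"

definition admits_split_idempotents :: "('o, 'm, 'z) braided_data_scheme \<Rightarrow> bool" where
  "admits_split_idempotents C \<longleftrightarrow>
     (\<forall>X \<in> Obj C. \<forall>q \<in> Hom C X X. q \<cdot>\<^bsub>C\<^esub> q = q \<longrightarrow> (\<exists>Y \<in> Obj C. \<exists>p i. splitting C X q Y p i))"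

locale algebra_in = strict_braided_monoidal_category C
  for C :: "('o, 'm, 'z) braided_data_scheme" (structure) +
  fixes A :: 'o and \<eta> \<mu> :: 'm
  assumes algebra_Obj: "A \<in> Obj C"
    and unit_Hom: "\<eta> \<in> Hom C \<K> A"
    and mult_Hom: "\<mu> \<in> Hom C (A \<odot> A) A"
    and mult_unit_left: "\<mu> \<cdot> (\<eta> \<otimes> \<one>A) = \<one>A"
    and mult_unit_right: "\<mu> \<cdot> (\<one>A \<otimes> \<eta>) = \<one>A"
    and mult_assoc: "\<mu> \<cdot> (\<mu> \<otimes> \<one>A) = \<mu> \<cdot> (\<one>A \<otimes> \<mu>)"

locale coalgebra_in = strict_braided_monoidal_category C
  for C :: "('o, 'm, 'z) braided_data_scheme" (structure) +
  fixes D :: 'o and \<epsilon> \<delta> :: 'm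
  assumes coalgebra_Obj: "D \<in> Obj C"
    and counit_Hom: "\<epsilon> \<in> Hom C D \<K>"
    and comult_Hom: "\<delta> \<in> Hom C D (D \<odot> D)"
    and comult_counit_left: "(\<epsilon> \<otimes> \<one>D) \<cdot> \<delta> = \<one>D"
    and comult_counit_right: "(\<one>D \<otimes> \<epsilon>) \<cdot> \<delta> = \<one>D"
    and comult_coassoc: "(\<delta> \<otimes> \<one>D) \<cdot> \<delta> = (\<one>D \<otimes> \<delta>) \<cdot> \<delta>"

definition coalgebra_morphism ::
  "('o, 'm, 'z) braided_data_scheme \<Rightarrow> 'o \<Rightarrow> 'm \<Rightarrow> 'm \<Rightarrow> 'o \<Rightarrow> 'm \<Rightarrow> 'm \<Rightarrow> 'm \<Rightarrow> bool" where
  "coalgebra_morphism C D \<epsilon>\<^sub>D \<delta>\<^sub>D E \<epsilon>\<^sub>E \<delta>\<^sub>E f \<longleftrightarrow>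
     f \<in> Hom C D E \<and> \<epsilon>\<^sub>E \<cdot>\<^bsub>C\<^esub> f = \<epsilon>\<^sub>D \<and> \<delta>\<^sub>E \<cdot>\<^bsub>C\<^esub> f = (f \<otimes>\<^bsub>C\<^esub> f) \<cdot>\<^bsub>C\<^esub> \<delta>\<^sub>D"

definition tensor_comult ::
  "('o, 'm, 'z) braided_data_scheme \<Rightarrow> 'o \<Rightarrow> 'm \<Rightarrow> 'o \<Rightarrow> 'm \<Rightarrow> 'm" where
  "tensor_comult C D \<delta>\<^sub>D E \<delta>\<^sub>E =
     (\<one>\<^bsub>C\<^esub>D \<otimes>\<^bsub>C\<^esub> \<c>\<^bsub>C\<^esub> D E \<otimes>\<^bsub>C\<^esub> \<one>\<^bsub>C\<^esub>E) \<cdot>\<^bsub>C\<^esub> (\<delta>\<^sub>D \<otimes>\<^bsub>C\<^esub> \<delta>\<^sub>E)"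

text \<open>
  In the first compatibility condition \<open>\<K>\<close> carries its trivial coalgebra structure, whose
  counit and coproduct are both \<open>\<one>\<K>\<close>.
\<close>

locale bialgebra_in = algebra_in C H \<eta> \<mu> + coalgebra_in C H \<epsilon> \<delta>
  for C :: "('o, 'm, 'z) braided_data_scheme" (structure) and H \<eta> \<mu> \<epsilon> \<delta> +
  assumes unit_coalgebra_morphism: "coalgebra_morphism C \<K> (\<one>\<K>) (\<one>\<K>) H \<epsilon> \<delta> \<eta>"
    and mult_coalgebra_morphism:
      "coalgebra_morphism C (H \<odot> H) (\<epsilon> \<otimes> \<epsilon>) (tensor_comult C H \<delta> H \<delta>) H \<epsilon> \<delta> \<mu>"

locale hopf_algebra_in = bialgebra_in C H \<eta> \<mu> \<epsilon> \<delta>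
  for C :: "('o, 'm, 'z) braided_data_scheme" (structure) and H \<eta> \<mu> \<epsilon> \<delta> +
  fixes S :: 'm
  assumes antipode_Hom: "S \<in> Hom C H H"
    and antipode_left: "\<mu> \<cdot> (S \<otimes> \<one>H) \<cdot> \<delta> = \<eta> \<cdot> \<epsilon>"
    and antipode_right: "\<mu> \<cdot> (\<one>H \<otimes> S) \<cdot> \<delta> = \<eta> \<cdot> \<epsilon>"

text \<open>\<open>a\<close> and \<open>b\<close> are the unit and counit, at \<open>\<K>\<close>, of the adjunction \<open>H \<otimes> - \<stileturn> H\<^sup>* \<otimes> -\<close>.\<close>

definition is_dual ::
  "('o, 'm, 'z) braided_data_scheme \<Rightarrow> 'o \<Rightarrow> 'o \<Rightarrow> 'm \<Rightarrow> 'm \<Rightarrow> bool" where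
  "is_dual C H H' a b \<longleftrightarrow>
     H' \<in> Obj C \<and>
     a \<in> Hom C \<K>\<^bsub>C\<^esub> (H' \<odot>\<^bsub>C\<^esub> H) \<and>
     b \<in> Hom C (H \<odot>\<^bsub>C\<^esub> H') \<K>\<^bsub>C\<^esub> \<and>
     (b \<otimes>\<^bsub>C\<^esub> \<one>\<^bsub>C\<^esub>H) \<cdot>\<^bsub>C\<^esub> (\<one>\<^bsub>C\<^esub>H \<otimes>\<^bsub>C\<^esub> a) = \<one>\<^bsub>C\<^esub>H \<and>
     (\<one>\<^bsub>C\<^esub>H' \<otimes>\<^bsub>C\<^esub> b) \<cdot>\<^bsub>C\<^esub> (a \<otimes>\<^bsub>C\<^esub> \<one>\<^bsub>C\<^esub>H') = \<one>\<^bsub>C\<^esub>H'"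

definition action_transpose ::
  "('o, 'm, 'z) braided_data_scheme \<Rightarrow> 'o \<Rightarrow> 'm \<Rightarrow> 'o \<Rightarrow> 'm \<Rightarrow> 'm" where
  "action_transpose C H m H' a =
     (\<one>\<^bsub>C\<^esub>H' \<otimes>\<^bsub>C\<^esub> m) \<cdot>\<^bsub>C\<^esub> (\<c>\<^bsub>C\<^esub> H H' \<otimes>\<^bsub>C\<^esub> \<one>\<^bsub>C\<^esub>H) \<cdot>\<^bsub>C\<^esub> (\<one>\<^bsub>C\<^esub>H \<otimes>\<^bsub>C\<^esub> a)"

definition convolution_invertible ::
  "('o, 'm, 'z) braided_data_scheme \<Rightarrow> 'o \<Rightarrow> 'm \<Rightarrow> 'm \<Rightarrow> 'o \<Rightarrow> 'm \<Rightarrow> 'm \<Rightarrow> 'm \<Rightarrow> bool" where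
  "convolution_invertible C H \<epsilon> \<delta> H' a b \<alpha> \<longleftrightarrow>
     (\<exists>\<beta> \<in> Hom C H (H' \<odot>\<^bsub>C\<^esub> H).
        (\<one>\<^bsub>C\<^esub>H' \<otimes>\<^bsub>C\<^esub> b \<otimes>\<^bsub>C\<^esub> \<one>\<^bsub>C\<^esub>H) \<cdot>\<^bsub>C\<^esub> (\<alpha> \<otimes>\<^bsub>C\<^esub> \<beta>) \<cdot>\<^bsub>C\<^esub> \<delta> = \<epsilon> \<otimes>\<^bsub>C\<^esub> a \<and>
        (\<one>\<^bsub>C\<^esub>H' \<otimes>\<^bsub>C\<^esub> b \<otimes>\<^bsub>C\<^esub> \<one>\<^bsub>C\<^esub>H) \<cdot>\<^bsub>C\<^esub> (\<beta> \<otimes>\<^bsub>C\<^esub> \<alpha>) \<cdot>\<^bsub>C\<^esub> \<delta> = \<epsilon> \<otimes>\<^bsub>C\<^esub> a)"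

definition mult_bar ::
  "('o, 'm, 'z) braided_data_scheme \<Rightarrow> 'o \<Rightarrow> 'm \<Rightarrow> 'm \<Rightarrow> 'm \<Rightarrow> 'm \<Rightarrow> 'm" where
  "mult_bar C H \<mu> \<delta> m \<Phi> = \<mu> \<cdot>\<^bsub>C\<^esub> (\<Phi> \<otimes>\<^bsub>C\<^esub> m) \<cdot>\<^bsub>C\<^esub> (\<delta> \<otimes>\<^bsub>C\<^esub> \<one>\<^bsub>C\<^esub>H)"

locale weak_twisted_post_hopf_algebra = hopf_algebra_in C H \<eta> \<mu> \<epsilon> \<delta> S
  for C :: "('o, 'm, 'z) braided_data_scheme" (structure) and H \<eta> \<mu> \<epsilon> \<delta> S +
  fixes m \<Phi> :: 'm
  assumes action_coalgebra_morphism: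
      "coalgebra_morphism C (H \<odot> H) (\<epsilon> \<otimes> \<epsilon>) (tensor_comult C H \<delta> H \<delta>) H \<epsilon> \<delta> m"
    and twist_coalgebra_morphism: "coalgebra_morphism C H \<epsilon> \<delta> H \<epsilon> \<delta> \<Phi>"
    and twist_mult:
      "\<Phi> \<cdot> \<mu> \<cdot> (\<Phi> \<otimes> m) \<cdot> (\<delta> \<otimes> \<one>H) = \<mu> \<cdot> (\<Phi> \<otimes> m) \<cdot> (\<delta> \<otimes> \<Phi>)"
    and action_action:
      "m \<cdot> (\<one>H \<otimes> m) = m \<cdot> ((\<mu> \<cdot> (\<Phi> \<otimes> m) \<cdot> (\<delta> \<otimes> \<one>H)) \<otimes> \<one>H)"
    and action_mult:
      "m \<cdot> (\<one>H \<otimes> \<mu>) = \<mu> \<cdot> (m \<otimes> m) \<cdot> (\<one>H \<otimes> \<c> H H \<otimes> \<one>H) \<cdot> (\<delta> \<otimes> \<one>H \<otimes> \<one>H)"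

text \<open>
  Finiteness of \<open>H\<close> is the existence of the dual \<open>(H', a, b)\<close>. Duals are unique up to
  isomorphism, and invertibility of the transposed action does not depend on the choice.
\<close>

locale twisted_post_hopf_algebra = weak_twisted_post_hopf_algebra C H \<eta> \<mu> \<epsilon> \<delta> S m \<Phi>
  for C :: "('o, 'm, 'z) braided_data_scheme" (structure) and H \<eta> \<mu> \<epsilon> \<delta> S m \<Phi> +
  assumes twist_unit: "\<Phi> \<cdot> \<eta> = \<eta>"
    and finite_transpose_invertible:
      "\<exists>H' a b. is_dual C H H' a b \<and>
         convolution_invertible C H \<epsilon> \<delta> H' a b (action_transpose C H m H' a)"

end

theory Submission
  imports Defs
begin

text \<open>
  Write \<open>x \<rhd> y\<close> for \<open>m\<close> and \<open>x * y\<close> for \<open>mult_bar\<close>, so that \<open>x * y = \<Phi>(x\<^sub>1)(x\<^sub>2 \<rhd> y)\<close>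
  in Sweedler notation. The product of \<open>I\<close> is \<open>*\<close> restricted along \<open>i\<close> and projected by \<open>p\<close>. The
  statement follows from these properties of \<open>*\<close> on \<open>H\<close> itself.

  \<^item> Units. The map \<open>x \<mapsto> x \<rhd> 1\<close> is a coalgebra morphism which, as \<open>\<rhd>\<close> is multiplicative in its second
    argument, is idempotent for convolution; the antipode makes it convolution invertible, so
    \<open>x \<rhd> 1 = \<epsilon>(x)1\<close> (\<open>action_unit\<close>) and hence \<open>x * 1 = \<Phi>(x)\<close>. Then \<open>1 * 1 = 1\<close>, so \<open>y \<mapsto> 1 \<rhd> y\<close> is
    idempotent; as the transposed action is convolution invertible and \<open>1\<close> is group-like, this map is
    also left invertible. So it is the identity (\<open>unit_action\<close>), and \<open>1 * y = y\<close>.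
  \<^item> \<open>*\<close> is a coalgebra morphism (\<open>counit_mbar\<close>, \<open>comult_mbar\<close>). The coproduct of \<open>x * y\<close> has the
    legs of \<open>x\<close> in the order \<open>1, 3, 2, 4\<close>, with legs 3 and 4 acting, and the cocommutativity
    hypothesis on \<open>\<rhd>\<close> exchanges legs 2 and 3.
  \<^item> \<open>*\<close> is associative (\<open>mbar_assoc\<close>): expanding with the axioms,
    \<open>x * (y * z) = \<Phi>(x\<^sub>1 * y\<^sub>1)((x\<^sub>2 * y\<^sub>2) \<rhd> z)\<close>, and this is \<open>(x * y) * z\<close> because \<open>*\<close> is
    comultiplicative.
  \<^item> \<open>x * \<Phi>(y) = \<Phi>(x * y)\<close> is an axiom, and \<open>\<Phi>(x) * y = (x * 1) * y = x * (1 * y) = x * y\<close>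
    (\<open>mbar_twist_right\<close>, \<open>mbar_twist_left\<close>).

  The last point lets every \<open>\<Phi> = i \<cdot> p\<close> that appears between two products on \<open>I\<close> be absorbed, so
  associativity and unitality pass to \<open>I\<close>; on \<open>I\<close> the element \<open>p \<cdot> \<eta>\<close> is also a right unit because
  \<open>p \<cdot> \<Phi> \<cdot> i\<close> is the identity. As \<open>\<Phi>\<close> is a coalgebra morphism, \<open>I\<close> is a coalgebra for which \<open>i\<close>
  and \<open>p\<close> are coalgebra morphisms (\<open>split_coalgebra\<close>), so its unit and product are composites of
  coalgebra morphisms.
\<close>

section \<open>Typing and interchange in strict braided monoidal categories\<close>

context strict_braided_monoidal_category
begin

lemma Hom_iff: "f \<in> Hom C X Y \<longleftrightarrow> f \<in> Arr C \<and> Dom C f = X \<and> Cod C f = Y"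
  by (simp add: Hom_def)

lemma HomD: "f \<in> Hom C X Y \<Longrightarrow> X \<in> Obj C" "f \<in> Hom C X Y \<Longrightarrow> Y \<in> Obj C"
  using Dom_Obj Cod_Obj by (auto simp: Hom_def)

lemma Arr_Hom: "f \<in> Arr C \<Longrightarrow> f \<in> Hom C (Dom C f) (Cod C f)"
  by (simp add: Hom_def)

lemma Ident_simps [simp]:
  assumes "X \<in> Obj C"
  shows "\<one>X \<in> Arr C" "Dom C (\<one>X) = X" "Cod C (\<one>X) = X"
  using Ident_Hom[OF assms] by (auto simp: Hom_def)

text \<open>
  The arrows with codomain \<open>X\<close>. As a side condition for composability, \<open>f \<in> Into (Dom C g)\<close> can be
  checked along a composite \<open>f\<^sub>1 \<cdot> f\<^sub>2 \<cdot> \<dots>\<close> in one pass, whereas checking \<open>f \<in> Arr C\<close> and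
  \<open>Cod C f = Dom C g\<close> separately doubles the work at each factor.
\<close>

definition Into :: "'o \<Rightarrow> 'm set" where
  "Into X = {f \<in> Arr C. Cod C f = X}"

lemma Comp_simps [simp]:
  assumes "g \<in> Arr C" "f \<in> Into (Dom C g)"
  shows "g \<cdot> f \<in> Arr C" "Dom C (g \<cdot> f) = Dom C f" "Cod C (g \<cdot> f) = Cod C g"
  using Comp_Hom[of f "Dom C f" "Cod C f" g "Cod C g"] assms by (auto simp: Hom_def Into_def)

lemma Into_Comp [simp]:
  "\<lbrakk>g \<in> Arr C; Cod C g = X; f \<in> Into (Dom C g)\<rbrakk> \<Longrightarrow> g \<cdot> f \<in> Into X"
  by (simp add: Into_def[of X])

lemma TensorA_simps [simp]:
  assumes "f \<in> Arr C" "g \<in> Arr C"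
  shows "f \<otimes> g \<in> Arr C" "Dom C (f \<otimes> g) = Dom C f \<odot> Dom C g"
    "Cod C (f \<otimes> g) = Cod C f \<odot> Cod C g"
  using TensorA_Hom[OF Arr_Hom Arr_Hom] assms by (auto simp: Hom_def)

lemma Into_simps [simp]:
  "X \<in> Obj C \<Longrightarrow> \<one>X \<in> Into Y \<longleftrightarrow> X = Y"
  "\<lbrakk>f \<in> Arr C; g \<in> Arr C\<rbrakk> \<Longrightarrow> f \<otimes> g \<in> Into Y \<longleftrightarrow> Cod C f \<odot> Cod C g = Y"
  by (auto simp: Into_def)

lemma Comp_assoc_simp:
  "\<lbrakk>h \<in> Arr C; g \<in> Into (Dom C h); f \<in> Into (Dom C g)\<rbrakk>
    \<Longrightarrow> (h \<cdot> g) \<cdot> f = h \<cdot> (g \<cdot> f)"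
  by (rule Comp_assoc[of f "Dom C f" "Cod C f" g "Cod C g" h "Cod C h"])
    (auto simp: Hom_def Into_def)

lemma Comp_Ident_simps [simp]:
  "\<lbrakk>f \<in> Arr C; Cod C f = Y\<rbrakk> \<Longrightarrow> \<one>Y \<cdot> f = f"
  "\<lbrakk>f \<in> Arr C; Dom C f = X\<rbrakk> \<Longrightarrow> f \<cdot> \<one>X = f"
  using Comp_Ident_left Comp_Ident_right by (auto simp: Hom_def)

lemma interchange_simp:
  "\<lbrakk>f \<in> Arr C; f' \<in> Arr C; g \<in> Arr C; g' \<in> Arr C; Cod C f = Dom C f'; Cod C g = Dom C g'\<rbrakk>
    \<Longrightarrow> (f' \<otimes> g') \<cdot> (f \<otimes> g) = (f' \<cdot> f) \<otimes> (g' \<cdot> g)"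
  by (rule interchange[symmetric]) (auto simp: Hom_def)

lemma interchange_tail:
  assumes "f \<in> Arr C" "f' \<in> Arr C" "g \<in> Arr C" "g' \<in> Arr C"
    and "Cod C f = Dom C f'" "Cod C g = Dom C g'" "r \<in> Into (Dom C f \<odot> Dom C g)"
  shows "(f' \<otimes> g') \<cdot> ((f \<otimes> g) \<cdot> r) = ((f' \<cdot> f) \<otimes> (g' \<cdot> g)) \<cdot> r"
  using assms by (simp add: Into_def flip: interchange_simp Comp_assoc_simp)

text \<open>
  Rewriting with these rules makes composition associate to the right and fuses adjacent tensor
  products whose factors match.
\<close>

lemmas merge_simps = Comp_assoc_simp interchange_simp interchange_tail

text \<open>
  The hexagons make \<open>\<c> X \<K>\<close> and \<open>\<c> \<K> X\<close> idempotent, and an invertible idempotent is an identity.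
\<close>

lemma Braid_unit:
  assumes "X \<in> Obj C"
  shows "\<c> X \<K> = \<one>X" "\<c> \<K> X = \<one>X"
proof -
  have c: "\<c> X \<K> \<in> Hom C X X" "\<c> \<K> X \<in> Hom C X X"
    using Braid_Hom assms Unit_Obj TensorO_Unit_left TensorO_Unit_right by metis+
  have idem: "\<c> X \<K> \<cdot> \<c> X \<K> = \<c> X \<K>" "\<c> \<K> X \<cdot> \<c> \<K> X = \<c> \<K> X"
    using hexagon_right[of X \<K> \<K>] hexagon_left[of \<K> \<K> X] assms Unit_Obj c
    by (auto simp: TensorO_Unit_left TensorA_Unit_left TensorA_Unit_right Hom_def)
  have idem_iso: "f = \<one>X" if "f \<in> Hom C X X" "d \<in> Hom C X X" "d \<cdot> f = \<one>X" "f \<cdot> f = f" for f d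
    using Comp_assoc[of f X X f X d X] Comp_Ident_left that by metis
  show "\<c> X \<K> = \<one>X"
    using Braid_iso[of X \<K>] assms Unit_Obj c idem idem_iso
    by (auto simp: TensorO_Unit_left TensorO_Unit_right)
  show "\<c> \<K> X = \<one>X"
    using Braid_iso[of \<K> X] assms Unit_Obj c idem idem_iso
    by (auto simp: TensorO_Unit_left TensorO_Unit_right)
qed

end

section \<open>String diagrams on tensor powers as words of layers\<close>

context strict_braided_monoidal_category
begin

text \<open>The tensor power of \<open>X\<close> with \<open>n\<close> factors; by strictness no bracketing has to be recorded.\<close>

primrec tpow :: "'o \<Rightarrow> nat \<Rightarrow> 'o" where
  "tpow X 0 = \<K>"
| "tpow X (Suc n) = X \<odot> tpow X n"

text \<open>
  The arrow \<open>f\<close> with \<open>a\<close> identity strands on its left and \<open>b\<close> on its right. Every string diagram on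
  tensor powers of \<open>X\<close> is a composite of such layers, each containing one generator.
\<close>

definition layer :: "'o \<Rightarrow> nat \<Rightarrow> 'm \<Rightarrow> nat \<Rightarrow> 'm" where
  "layer X a f b = \<one>(tpow X a) \<otimes> f \<otimes> \<one>(tpow X b)"

lemma tpow_Obj [simp]: "X \<in> Obj C \<Longrightarrow> tpow X n \<in> Obj C"
  by (induction n) (auto simp: Unit_Obj TensorO_Obj)

lemma tpow_add: "X \<in> Obj C \<Longrightarrow> tpow X a \<odot> tpow X b = tpow X (a + b)"
  by (induction a) (auto simp: TensorO_Unit_left TensorO_assoc)

lemma Ident_tpow_tensor:
  "X \<in> Obj C \<Longrightarrow> \<one>(tpow X a) \<otimes> \<one>(tpow X b) = \<one>(tpow X (a + b))"
  by (simp add: TensorA_Ident tpow_add)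

lemma layer_Hom:
  assumes "X \<in> Obj C" "f \<in> Hom C (tpow X s) (tpow X t)"
  shows "layer X a f b \<in> Hom C (tpow X (a + s + b)) (tpow X (a + t + b))"
  using assms by (auto simp: layer_def Hom_def tpow_add add.assoc)

lemma layer_comp:
  "\<lbrakk>X \<in> Obj C; g \<in> Arr C; f \<in> Into (Dom C g)\<rbrakk>
    \<Longrightarrow> layer X a (g \<cdot> f) b = layer X a g b \<cdot> layer X a f b"
  by (simp add: layer_def interchange_simp Into_def)

lemma layer_layer:
  assumes "X \<in> Obj C" "f \<in> Arr C"
  shows "layer X a (layer X c f d) b = layer X (a + c) f (d + b)"
  using assms by (simp add: layer_def TensorA_assoc flip: Ident_tpow_tensor)

lemma layer_0: "f \<in> Arr C \<Longrightarrow> layer X 0 f 0 = f"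
  by (simp add: layer_def TensorA_Unit_left TensorA_Unit_right)

lemma layer_eqI:
  assumes "f \<in> Arr C" "g \<in> Arr C" "layer X 0 f 0 = layer X 0 g 0"
  shows "f = g"
  using assms by (simp add: layer_0)

lemma layer_Ident: "X \<in> Obj C \<Longrightarrow> layer X a (\<one>(tpow X n)) b = \<one>(tpow X (a + n + b))"
  by (simp add: layer_def Ident_tpow_tensor add.assoc)

lemma layer_Into:
  assumes "X \<in> Obj C" "f \<in> Hom C (tpow X s) (tpow X t)"
  shows "layer X a f b \<in> Into Y \<longleftrightarrow> tpow X (a + t + b) = Y"
  using layer_Hom[OF assms, of a b] by (auto simp: Into_def Hom_def)

lemma Hom_Into: "f \<in> Hom C X Y \<Longrightarrow> f \<in> Into Z \<longleftrightarrow> Y = Z"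
  by (auto simp: Into_def Hom_def)

lemma tensor_eq_layers:
  assumes "X \<in> Obj C" "f \<in> Hom C (tpow X s) (tpow X t)" "g \<in> Hom C (tpow X u) (tpow X v)"
  shows "f \<otimes> g = layer X t g 0 \<cdot> layer X 0 f u"
  using assms
  by (auto simp: layer_def Hom_def interchange_simp TensorA_Unit_left TensorA_Unit_right)

text \<open>
  The interchange law for layers: two arrows \<open>f\<close> and \<open>g\<close> that act on disjoint strands commute, after
  their offsets are corrected for the strands that the other one creates or removes. Used from left
  to right, \<open>slide\<close> applies the arrow further to the left first.
\<close>

lemma slide_aux:
  assumes "X \<in> Obj C" "f \<in> Hom C (tpow X s) (tpow X t)" "g \<in> Hom C (tpow X u) (tpow X v)"
  shows "layer X 0 f (b + v) \<cdot> layer X (s + b) g 0 = layer X (t + b) g 0 \<cdot> layer X 0 f (b + u)"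
proof -
  let ?h = "layer X b g 0"
  have h: "?h \<in> Hom C (tpow X (b + u)) (tpow X (b + v))"
    using layer_Hom[OF assms(1,3), of b 0] by simp
  have l: "layer X 0 k n = k \<otimes> \<one>(tpow X n)" "layer X n k 0 = \<one>(tpow X n) \<otimes> k" if "k \<in> Arr C" for k n
    using that assms(1) by (auto simp: layer_def TensorA_Unit_left TensorA_Unit_right)
  have ll: "layer X (n + b) g 0 = layer X n ?h 0" for n
    using layer_layer[OF assms(1), of g n b 0 0] assms(3) by (simp add: Hom_def)
  show ?thesis
    unfolding ll using h assms by (simp add: l Hom_def interchange_simp)
qed

lemma slide:
  assumes "X \<in> Obj C" "f \<in> Hom C (tpow X s) (tpow X t)" "g \<in> Hom C (tpow X u) (tpow X v)"
    and "a + s \<le> d" "a + s + e = d + v + c"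
  shows "layer X a f e \<cdot> layer X d g c = layer X (d - s + t) g c \<cdot> layer X a f (e - v + u)"
proof -
  define b where "b = d - (a + s)"
  have d: "d = a + (s + b)" and e: "e = (b + v) + c"
    using assms(4,5) by (auto simp: b_def)
  have A: "f \<in> Arr C" "g \<in> Arr C" using assms by (auto simp: Hom_def)
  have ar: "layer X 0 f (b + n) \<in> Hom C (tpow X (s + b + n)) (tpow X (t + b + n))"
       "layer X (n + b) g 0 \<in> Hom C (tpow X (n + b + u)) (tpow X (n + b + v))" for n
    using layer_Hom[OF assms(1,2), of 0 "b + n"] layer_Hom[OF assms(1,3), of "n + b" 0]
    by (auto simp: ac_simps)
  have "layer X a (layer X 0 f (b + v) \<cdot> layer X (s + b) g 0) c =
        layer X a (layer X (t + b) g 0 \<cdot> layer X 0 f (b + u)) c"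
    by (simp add: slide_aux[OF assms(1-3)])
  moreover have "d - s + t = a + (t + b)" "e - v + u = b + u + c"
    by (auto simp: d e)
  ultimately show ?thesis
    using assms(1) A ar[of u] ar[of v] ar[of s] ar[of t]
    by (simp add: d e layer_comp layer_layer Hom_def Into_def add.assoc add.commute add.left_commute)
qed

lemma slide_tail:
  assumes "X \<in> Obj C" "f \<in> Hom C (tpow X s) (tpow X t)" "g \<in> Hom C (tpow X u) (tpow X v)"
    and "a + s \<le> d" "a + s + e = d + v + c"
    and "r \<in> Into (tpow X (d + u + c))"
  shows "layer X a f e \<cdot> (layer X d g c \<cdot> r)
       = layer X (d - s + t) g c \<cdot> (layer X a f (e - v + u) \<cdot> r)"
proof -
  define a' e' where "a' = d - s + t" and "e' = e - v + u"
  have t: "a' + u + c = a + t + e'" "a + s + e' = d + u + c" "a + s + e = d + v + c"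
    using assms(4,5) by (auto simp: a'_def e'_def)
  show ?thesis
    using slide[OF assms(1-5), folded a'_def e'_def]
      Comp_assoc[of r "Dom C r" "tpow X (d + u + c)" "layer X d g c" "tpow X (d + v + c)"
         "layer X a f e" "tpow X (a + t + e)"]
      Comp_assoc[of r "Dom C r" "tpow X (d + u + c)" "layer X a f e'" "tpow X (a' + u + c)"
         "layer X a' g c" "tpow X (a' + v + c)"]
      layer_Hom[OF assms(1,2), of a e] layer_Hom[OF assms(1,2), of a e']
      layer_Hom[OF assms(1,3), of d c] layer_Hom[OF assms(1,3), of a' c] assms(6) t
    by (simp add: Into_def Hom_def flip: a'_def e'_def)
qed

end

section \<open>Coalgebra morphisms\<close>

lemma (in strict_braided_monoidal_category) coalgebra_morphism_comp:
  assumes f: "coalgebra_morphism C D \<epsilon>\<^sub>D \<delta>\<^sub>D E \<epsilon>\<^sub>E \<delta>\<^sub>E f"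
    and g: "coalgebra_morphism C E \<epsilon>\<^sub>E \<delta>\<^sub>E F \<epsilon>\<^sub>F \<delta>\<^sub>F g"
    and Homs: "\<epsilon>\<^sub>F \<in> Hom C F \<K>" "\<delta>\<^sub>D \<in> Hom C D (D \<odot> D)" "\<delta>\<^sub>E \<in> Hom C E (E \<odot> E)" "\<delta>\<^sub>F \<in> Hom C F (F \<odot> F)"
  shows "coalgebra_morphism C D \<epsilon>\<^sub>D \<delta>\<^sub>D F \<epsilon>\<^sub>F \<delta>\<^sub>F (g \<cdot> f)"
proof -
  have f': "f \<in> Hom C D E" "\<epsilon>\<^sub>E \<cdot> f = \<epsilon>\<^sub>D" "\<delta>\<^sub>E \<cdot> f = (f \<otimes> f) \<cdot> \<delta>\<^sub>D"
    and g': "g \<in> Hom C E F" "\<epsilon>\<^sub>F \<cdot> g = \<epsilon>\<^sub>E" "\<delta>\<^sub>F \<cdot> g = (g \<otimes> g) \<cdot> \<delta>\<^sub>E"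
    using f g by (auto simp: coalgebra_morphism_def)
  note typing = Homs[unfolded Hom_iff] Homs[THEN Hom_Into] f'(1)[unfolded Hom_iff]
    g'(1)[unfolded Hom_iff] f'(1)[THEN Hom_Into] g'(1)[THEN Hom_Into]
  have "\<epsilon>\<^sub>F \<cdot> (g \<cdot> f) = (\<epsilon>\<^sub>F \<cdot> g) \<cdot> f" and "\<delta>\<^sub>F \<cdot> (g \<cdot> f) = (\<delta>\<^sub>F \<cdot> g) \<cdot> f"
    by (simp_all add: typing Comp_assoc_simp)
  then have "\<epsilon>\<^sub>F \<cdot> (g \<cdot> f) = \<epsilon>\<^sub>D" and "\<delta>\<^sub>F \<cdot> (g \<cdot> f) = (g \<otimes> g) \<cdot> (\<delta>\<^sub>E \<cdot> f)"
    using f' g' by (simp_all add: typing Comp_assoc_simp)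
  then show ?thesis
    using f' g' by (simp add: coalgebra_morphism_def typing merge_simps Comp_Hom[OF f'(1) g'(1)])
qed

lemma (in strict_braided_monoidal_category) coalgebra_morphism_tensor:
  assumes f: "coalgebra_morphism C D \<epsilon>\<^sub>D \<delta>\<^sub>D E \<epsilon>\<^sub>E \<delta>\<^sub>E f"
    and g: "coalgebra_morphism C D' \<epsilon>\<^sub>D' \<delta>\<^sub>D' E' \<epsilon>\<^sub>E' \<delta>\<^sub>E' g"
    and Homs: "\<epsilon>\<^sub>E \<in> Hom C E \<K>" "\<epsilon>\<^sub>E' \<in> Hom C E' \<K>" "\<delta>\<^sub>D \<in> Hom C D (D \<odot> D)" "\<delta>\<^sub>D' \<in> Hom C D' (D' \<odot> D')"
      "\<delta>\<^sub>E \<in> Hom C E (E \<odot> E)" "\<delta>\<^sub>E' \<in> Hom C E' (E' \<odot> E')"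
  shows "coalgebra_morphism C (D \<odot> D') (\<epsilon>\<^sub>D \<otimes> \<epsilon>\<^sub>D') (tensor_comult C D \<delta>\<^sub>D D' \<delta>\<^sub>D')
    (E \<odot> E') (\<epsilon>\<^sub>E \<otimes> \<epsilon>\<^sub>E') (tensor_comult C E \<delta>\<^sub>E E' \<delta>\<^sub>E') (f \<otimes> g)"
proof -
  have f': "f \<in> Hom C D E" "\<epsilon>\<^sub>E \<cdot> f = \<epsilon>\<^sub>D" "\<delta>\<^sub>E \<cdot> f = (f \<otimes> f) \<cdot> \<delta>\<^sub>D"
    and g': "g \<in> Hom C D' E'" "\<epsilon>\<^sub>E' \<cdot> g = \<epsilon>\<^sub>D'" "\<delta>\<^sub>E' \<cdot> g = (g \<otimes> g) \<cdot> \<delta>\<^sub>D'"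
    using f g by (auto simp: coalgebra_morphism_def)
  have Obj: "D \<in> Obj C" "E \<in> Obj C" "D' \<in> Obj C" "E' \<in> Obj C"
    using HomD f'(1) g'(1) by blast+
  note Homs' = Homs f'(1) g'(1) Braid_Hom[OF Obj(1,3)] Braid_Hom[OF Obj(2,4)]
  note typing = Homs'[unfolded Hom_iff] Homs'[THEN Hom_Into] Obj TensorO_assoc TensorO_Obj
  have "tensor_comult C E \<delta>\<^sub>E E' \<delta>\<^sub>E' \<cdot> (f \<otimes> g)
      = (\<one>E \<otimes> \<c> E E' \<otimes> \<one>E') \<cdot> ((\<delta>\<^sub>E \<cdot> f) \<otimes> (\<delta>\<^sub>E' \<cdot> g))"
    by (simp add: tensor_comult_def typing merge_simps)
  also have "\<dots> = (\<one>E \<otimes> \<c> E E' \<otimes> \<one>E') \<cdot> (f \<otimes> (f \<otimes> g) \<otimes> g) \<cdot> (\<delta>\<^sub>D \<otimes> \<delta>\<^sub>D')"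
    unfolding f'(3) g'(3)
    using interchange_simp[of \<delta>\<^sub>D "f \<otimes> f" \<delta>\<^sub>D' "g \<otimes> g"] by (simp add: typing TensorA_assoc)
  also have "\<dots> = (f \<otimes> (\<c> E E' \<cdot> (f \<otimes> g)) \<otimes> g) \<cdot> (\<delta>\<^sub>D \<otimes> \<delta>\<^sub>D')"
    by (simp add: typing merge_simps)
  also have "\<dots> = (f \<otimes> ((g \<otimes> f) \<cdot> \<c> D D') \<otimes> g) \<cdot> (\<delta>\<^sub>D \<otimes> \<delta>\<^sub>D')"
    by (simp only: Braid_natural[OF f'(1) g'(1)])
  also have "\<dots> = (f \<otimes> (g \<otimes> f) \<otimes> g) \<cdot> tensor_comult C D \<delta>\<^sub>D D' \<delta>\<^sub>D'"
    by (simp add: tensor_comult_def typing merge_simps)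
  also have "f \<otimes> (g \<otimes> f) \<otimes> g = (f \<otimes> g) \<otimes> (f \<otimes> g)"
    by (simp add: typing TensorA_assoc)
  finally show ?thesis
    using f' g' by (simp add: coalgebra_morphism_def typing interchange_simp TensorA_Hom)
qed

text \<open>
  If an idempotent coalgebra morphism splits, its image is a coalgebra, and both maps of the
  splitting are coalgebra morphisms.
\<close>

lemma (in coalgebra_in) split_coalgebra:
  assumes split: "splitting C D f E p i" and f: "coalgebra_morphism C D \<epsilon> \<delta> D \<epsilon> \<delta> f"
  defines "\<delta>\<^sub>E \<equiv> (p \<otimes> p) \<cdot> \<delta> \<cdot> i"
  shows "coalgebra_in C E (\<epsilon> \<cdot> i) \<delta>\<^sub>E"
    and "coalgebra_morphism C E (\<epsilon> \<cdot> i) \<delta>\<^sub>E D \<epsilon> \<delta> i"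
    and "coalgebra_morphism C D \<epsilon> \<delta> E (\<epsilon> \<cdot> i) \<delta>\<^sub>E p"
proof -
  have p: "p \<in> Hom C D E" and i: "i \<in> Hom C E D" and ip: "i \<cdot> p = f" and pi: "p \<cdot> i = \<one>E"
    using split by (auto simp: splitting_def)
  have f_Hom: "f \<in> Hom C D D" and \<epsilon>f: "\<epsilon> \<cdot> f = \<epsilon>" and \<delta>f: "\<delta> \<cdot> f = (f \<otimes> f) \<cdot> \<delta>"
    using f by (auto simp: coalgebra_morphism_def)
  have E: "E \<in> Obj C" using HomD p by blast
  note Homs0 = p i f_Hom counit_Hom comult_Hom
  note typing0 = Homs0[unfolded Hom_iff] Homs0[THEN Hom_Into] coalgebra_Obj E Unit_Obj
    TensorO_assoc TensorO_Unit_left TensorO_Unit_right TensorO_Obj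
  have \<delta>E: "\<delta>\<^sub>E \<in> Hom C E (E \<odot> E)"
    by (simp add: \<delta>\<^sub>E_def Hom_iff typing0)
  note typing = typing0 \<delta>E[unfolded Hom_iff] \<delta>E[THEN Hom_Into]
  have fi: "f \<cdot> i = i" and pf: "p \<cdot> f = p"
    unfolding ip[symmetric] using pi by (simp_all add: typing Comp_assoc_simp)
      (simp add: typing pi flip: Comp_assoc_simp)
  have \<delta>i: "\<delta> \<cdot> i = (i \<otimes> i) \<cdot> \<delta>\<^sub>E"
  proof -
    have "(i \<otimes> i) \<cdot> \<delta>\<^sub>E = ((f \<otimes> f) \<cdot> \<delta>) \<cdot> i"
      by (simp add: \<delta>\<^sub>E_def typing merge_simps ip)
    also have "\<dots> = \<delta> \<cdot> (f \<cdot> i)"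
      unfolding \<delta>f[symmetric] by (simp add: typing Comp_assoc_simp)
    finally show ?thesis by (simp add: fi)
  qed
  have \<delta>p: "\<delta>\<^sub>E \<cdot> p = (p \<otimes> p) \<cdot> \<delta>"
  proof -
    have "\<delta>\<^sub>E \<cdot> p = (p \<otimes> p) \<cdot> (\<delta> \<cdot> f)"
      by (simp add: \<delta>\<^sub>E_def typing Comp_assoc_simp ip)
    also have "\<dots> = (p \<otimes> p) \<cdot> \<delta>"
      unfolding \<delta>f by (simp add: typing merge_simps pf)
    finally show ?thesis .
  qed
  have \<epsilon>p: "(\<epsilon> \<cdot> i) \<cdot> p = \<epsilon>"
    by (simp add: typing Comp_assoc_simp ip \<epsilon>f)
  show "coalgebra_morphism C E (\<epsilon> \<cdot> i) \<delta>\<^sub>E D \<epsilon> \<delta> i"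
    by (simp add: coalgebra_morphism_def i \<delta>i)
  show "coalgebra_morphism C D \<epsilon> \<delta> E (\<epsilon> \<cdot> i) \<delta>\<^sub>E p"
    by (simp add: coalgebra_morphism_def p \<delta>p \<epsilon>p)
  have left: "((\<epsilon> \<cdot> i) \<otimes> \<one>E) \<cdot> \<delta>\<^sub>E = \<one>E"
  proof -
    have "((\<epsilon> \<cdot> i) \<otimes> \<one>E) \<cdot> \<delta>\<^sub>E = (\<epsilon> \<otimes> p) \<cdot> \<delta> \<cdot> i"
      by (simp add: \<delta>\<^sub>E_def typing merge_simps ip \<epsilon>f)
    also have "\<dots> = (\<one>\<K> \<otimes> p) \<cdot> ((\<epsilon> \<otimes> \<one>D) \<cdot> \<delta>) \<cdot> i"
      by (simp add: typing merge_simps)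
    finally show ?thesis
      by (simp add: comult_counit_left typing TensorA_Unit_left pi)
  qed
  have right: "(\<one>E \<otimes> (\<epsilon> \<cdot> i)) \<cdot> \<delta>\<^sub>E = \<one>E"
  proof -
    have "(\<one>E \<otimes> (\<epsilon> \<cdot> i)) \<cdot> \<delta>\<^sub>E = (p \<otimes> \<epsilon>) \<cdot> \<delta> \<cdot> i"
      by (simp add: \<delta>\<^sub>E_def typing merge_simps ip \<epsilon>f)
    also have "\<dots> = (p \<otimes> \<one>\<K>) \<cdot> ((\<one>D \<otimes> \<epsilon>) \<cdot> \<delta>) \<cdot> i"
      by (simp add: typing merge_simps)
    finally show ?thesis
      by (simp add: comult_counit_right typing TensorA_Unit_right pi)
  qed
  have coassoc: "(\<delta>\<^sub>E \<otimes> \<one>E) \<cdot> \<delta>\<^sub>E = (\<one>E \<otimes> \<delta>\<^sub>E) \<cdot> \<delta>\<^sub>E"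
  proof -
    have "(\<delta>\<^sub>E \<otimes> \<one>E) \<cdot> \<delta>\<^sub>E = ((\<delta>\<^sub>E \<cdot> p) \<otimes> p) \<cdot> \<delta> \<cdot> i"
      by (subst (2) \<delta>\<^sub>E_def) (simp add: typing merge_simps)
    also have "\<dots> = ((p \<otimes> p) \<otimes> p) \<cdot> ((\<delta> \<otimes> \<one>D) \<cdot> \<delta>) \<cdot> i"
      unfolding \<delta>p by (simp add: typing merge_simps)
    also have "\<dots> = (p \<otimes> (p \<otimes> p)) \<cdot> ((\<one>D \<otimes> \<delta>) \<cdot> \<delta>) \<cdot> i"
      by (simp add: comult_coassoc typing TensorA_assoc)
    also have "\<dots> = (p \<otimes> (\<delta>\<^sub>E \<cdot> p)) \<cdot> \<delta> \<cdot> i"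
      unfolding \<delta>p by (simp add: typing merge_simps)
    also have "\<dots> = (\<one>E \<otimes> \<delta>\<^sub>E) \<cdot> \<delta>\<^sub>E"
      by (subst (3) \<delta>\<^sub>E_def) (simp add: typing merge_simps)
    finally show ?thesis .
  qed
  show "coalgebra_in C E (\<epsilon> \<cdot> i) \<delta>\<^sub>E"
    by unfold_locales (use left right coassoc E \<delta>E in \<open>auto simp: typing Hom_iff\<close>)
qed

text \<open>
  A coalgebra endomorphism \<open>f\<close> of a Hopf algebra has the convolution inverse \<open>S \<cdot> f\<close>; so if \<open>f\<close> is
  idempotent for convolution, it is the convolution unit \<open>\<eta> \<cdot> \<epsilon>\<close>.
\<close>

lemma (in hopf_algebra_in) convolution_idempotent_trivial:
  assumes f: "coalgebra_morphism C H \<epsilon> \<delta> H \<epsilon> \<delta> f" and idem: "\<mu> \<cdot> (f \<otimes> f) \<cdot> \<delta> = f"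
  shows "f = \<eta> \<cdot> \<epsilon>"
proof -
  have f_Hom: "f \<in> Hom C H H" and \<epsilon>f: "\<epsilon> \<cdot> f = \<epsilon>" and \<delta>f: "\<delta> \<cdot> f = (f \<otimes> f) \<cdot> \<delta>"
    using f by (auto simp: coalgebra_morphism_def)
  note Homs = f_Hom mult_Hom comult_Hom unit_Hom counit_Hom antipode_Hom
  note typing = Homs[unfolded Hom_iff] Homs[THEN Hom_Into] algebra_Obj Unit_Obj
    TensorO_assoc TensorO_Unit_left TensorO_Unit_right TensorO_Obj
  let ?g = "S \<cdot> f"
  have inv: "\<mu> \<cdot> (f \<otimes> ?g) \<cdot> \<delta> = \<eta> \<cdot> \<epsilon>"
  proof -
    have "\<mu> \<cdot> (f \<otimes> ?g) \<cdot> \<delta> = (\<mu> \<cdot> (\<one>H \<otimes> S)) \<cdot> ((f \<otimes> f) \<cdot> \<delta>)"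
      by (simp add: typing merge_simps)
    also have "\<dots> = (\<mu> \<cdot> (\<one>H \<otimes> S) \<cdot> \<delta>) \<cdot> f"
      unfolding \<delta>f[symmetric] by (simp add: typing Comp_assoc_simp)
    also have "\<dots> = \<eta> \<cdot> \<epsilon>"
      unfolding antipode_right by (simp add: typing Comp_assoc_simp \<epsilon>f)
    finally show ?thesis .
  qed
  have "f = (\<mu> \<cdot> (\<one>H \<otimes> \<eta>)) \<cdot> (f \<otimes> \<one>\<K>) \<cdot> ((\<one>H \<otimes> \<epsilon>) \<cdot> \<delta>)"
    unfolding mult_unit_right comult_counit_right by (simp add: typing TensorA_Unit_right)
  also have "\<dots> = \<mu> \<cdot> (f \<otimes> (\<eta> \<cdot> \<epsilon>)) \<cdot> \<delta>"
    by (simp add: typing merge_simps)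
  also have "\<dots> = \<mu> \<cdot> (f \<otimes> (\<mu> \<cdot> (f \<otimes> ?g) \<cdot> \<delta>)) \<cdot> \<delta>"
    by (simp only: inv)
  also have "\<dots> = (\<mu> \<cdot> (\<one>H \<otimes> \<mu>)) \<cdot> (f \<otimes> f \<otimes> ?g) \<cdot> ((\<one>H \<otimes> \<delta>) \<cdot> \<delta>)"
    by (simp add: typing merge_simps)
  also have "\<dots> = (\<mu> \<cdot> (\<mu> \<otimes> \<one>H)) \<cdot> ((f \<otimes> f) \<otimes> ?g) \<cdot> ((\<delta> \<otimes> \<one>H) \<cdot> \<delta>)"
    by (simp add: typing TensorA_assoc mult_assoc comult_coassoc)
  also have "\<dots> = \<mu> \<cdot> ((\<mu> \<cdot> (f \<otimes> f) \<cdot> \<delta>) \<otimes> ?g) \<cdot> \<delta>"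
    by (simp add: typing merge_simps)
  also have "\<dots> = \<eta> \<cdot> \<epsilon>"
    by (simp only: idem inv)
  finally show ?thesis .
qed

section \<open>Normalizing diagrams in a weak twisted post-Hopf algebra\<close>

context weak_twisted_post_hopf_algebra
begin

abbreviation lay :: "nat \<Rightarrow> 'm \<Rightarrow> nat \<Rightarrow> 'm"  ("\<langle>_|_|_\<rangle>" [51, 51, 51] 1000) where
  "\<langle>a|f|b\<rangle> \<equiv> layer H a f b"

text \<open>The derived product \<open>x * y = \<Phi>(x\<^sub>1)(x\<^sub>2 \<rhd> y)\<close>.\<close>

abbreviation mbar :: 'm where
  "mbar \<equiv> mult_bar C H \<mu> \<delta> m \<Phi>"

(* Strand counts are kept as numerals, so that offsets are computed by arithmetic. *)
declare tpow.simps [simp del] One_nat_def [simp del]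

lemma tpow_1: "tpow H 1 = H" and tpow_2: "tpow H 2 = H \<odot> H"
  by (auto simp: tpow.simps One_nat_def numeral_2_eq_2 TensorO_Unit_right algebra_Obj)

lemma action_Hom: "m \<in> Hom C (H \<odot> H) H" and twist_Hom: "\<Phi> \<in> Hom C H H"
  using action_coalgebra_morphism twist_coalgebra_morphism by (auto simp: coalgebra_morphism_def)

lemma mbar_Hom: "mbar \<in> Hom C (H \<odot> H) H"
  using action_Hom twist_Hom comult_Hom mult_Hom algebra_Obj
  by (simp add: mult_bar_def Hom_def TensorO_assoc)

text \<open>The generators of the diagrams, typed by their numbers of input and output strands.\<close>

lemma gens:
  "\<mu> \<in> Hom C (tpow H 2) (tpow H 1)" "\<delta> \<in> Hom C (tpow H 1) (tpow H 2)"
  "m \<in> Hom C (tpow H 2) (tpow H 1)" "\<Phi> \<in> Hom C (tpow H 1) (tpow H 1)"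
  "mbar \<in> Hom C (tpow H 2) (tpow H 1)" "\<c> H H \<in> Hom C (tpow H 2) (tpow H 2)"
  "\<epsilon> \<in> Hom C (tpow H 1) (tpow H 0)" "\<eta> \<in> Hom C (tpow H 0) (tpow H 1)"
  using mult_Hom comult_Hom action_Hom twist_Hom counit_Hom unit_Hom mbar_Hom
    Braid_Hom algebra_Obj
  by (auto simp: tpow_1 tpow_2 tpow.simps(1))

lemmas gens_simps = gens[unfolded Hom_iff]
lemmas gens_layers = gens[THEN layer_Hom[OF algebra_Obj], unfolded Hom_iff]
lemmas gens_tensor0 = gens[THEN tensor_eq_layers[OF algebra_Obj]]
lemmas gens_tensor =
  gens[THEN gens_tensor0(1)] gens[THEN gens_tensor0(2)] gens[THEN gens_tensor0(3)]
  gens[THEN gens_tensor0(4)] gens[THEN gens_tensor0(5)] gens[THEN gens_tensor0(6)]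
  gens[THEN gens_tensor0(7)] gens[THEN gens_tensor0(8)]
lemmas gens_slide0 = gens[THEN slide[OF algebra_Obj]]
lemmas gens_slide_tail0 = gens[THEN slide_tail[OF algebra_Obj]]
lemmas gens_slide =
  gens[THEN gens_slide0(1)] gens[THEN gens_slide0(2)] gens[THEN gens_slide0(3)]
  gens[THEN gens_slide0(4)] gens[THEN gens_slide0(5)] gens[THEN gens_slide0(6)]
  gens[THEN gens_slide0(7)] gens[THEN gens_slide0(8)]
  gens[THEN gens_slide_tail0(1)] gens[THEN gens_slide_tail0(2)] gens[THEN gens_slide_tail0(3)]
  gens[THEN gens_slide_tail0(4)] gens[THEN gens_slide_tail0(5)] gens[THEN gens_slide_tail0(6)]
  gens[THEN gens_slide_tail0(7)] gens[THEN gens_slide_tail0(8)]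

lemma tensor_Ident:
  "f \<in> Arr C \<Longrightarrow> \<one>H \<otimes> f = \<langle>1|f|0\<rangle>"
  "f \<in> Arr C \<Longrightarrow> f \<otimes> \<one>H = \<langle>0|f|1\<rangle>"
  "f \<in> Arr C \<Longrightarrow> f \<otimes> \<one>(tpow H n) = \<langle>0|f|n\<rangle>"
  by (simp_all add: layer_def TensorA_Unit_left TensorA_Unit_right tpow_1 tpow.simps(1) algebra_Obj)

lemma layer_Ident_1: "\<langle>a|\<one>H|b\<rangle> = \<one>(tpow H (a + 1 + b))"
  using layer_Ident[of H a 1 b] algebra_Obj by (simp add: tpow_1)

text \<open>
  These rules turn an arrow built from generators into a word of layers and sort the word by sliding,
  so that the diagrams below that differ only by interchange are rewritten to the same word. In the
  calculations, a composite arrow inside a layer is a subdiagram to which an axiom is applied.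
\<close>

lemmas lay_simps = algebra_Obj gens_simps gens_layers gens[THEN Hom_Into]
  gens[THEN layer_Into[OF algebra_Obj]] gens_tensor gens_slide tensor_Ident
  layer_Ident_1 layer_Ident layer_comp layer_layer Comp_assoc_simp
  One_nat_def[symmetric] numeral_2_eq_2[symmetric]

section \<open>The derived product on the whole Hopf algebra\<close>

lemma mbar_eq: "mbar = \<mu> \<cdot> (\<Phi> \<otimes> m) \<cdot> (\<delta> \<otimes> \<one>H)"
  by (simp add: mult_bar_def)

lemma comult_mult: "\<delta> \<cdot> \<mu> = (\<mu> \<otimes> \<mu>) \<cdot> (\<one>H \<otimes> \<c> H H \<otimes> \<one>H) \<cdot> (\<delta> \<otimes> \<delta>)"
  using mult_coalgebra_morphism by (simp add: coalgebra_morphism_def tensor_comult_def)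

lemma comult_action: "\<delta> \<cdot> m = (m \<otimes> m) \<cdot> (\<one>H \<otimes> \<c> H H \<otimes> \<one>H) \<cdot> (\<delta> \<otimes> \<delta>)"
  using action_coalgebra_morphism by (simp add: coalgebra_morphism_def tensor_comult_def)

lemma comult_twist: "\<delta> \<cdot> \<Phi> = (\<Phi> \<otimes> \<Phi>) \<cdot> \<delta>"
  using twist_coalgebra_morphism by (simp add: coalgebra_morphism_def)

text \<open>\<open>x \<rhd> (y * z) = (x\<^sub>1 \<rhd> \<Phi>(y\<^sub>1)) ((x\<^sub>2 * y\<^sub>2) \<rhd> z)\<close>\<close>

lemma action_mbar:
  "m \<cdot> (\<one>H \<otimes> mbar) =
   \<langle>0|\<mu>|0\<rangle> \<cdot> \<langle>0|m|1\<rangle> \<cdot> \<langle>1|\<Phi>|1\<rangle> \<cdot> \<langle>2|m|0\<rangle> \<cdot> \<langle>2|mbar|1\<rangle> \<cdot> \<langle>1|\<c> H H|2\<rangle> \<cdot> \<langle>0|\<delta>|3\<rangle> \<cdot> \<langle>1|\<delta>|1\<rangle>"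
proof -
  have "m \<cdot> (\<one>H \<otimes> mbar) = \<langle>0|m \<cdot> (\<one>H \<otimes> \<mu>)|0\<rangle> \<cdot> \<langle>1|\<Phi>|1\<rangle> \<cdot> \<langle>2|m|0\<rangle> \<cdot> \<langle>1|\<delta>|1\<rangle>"
    by (rule layer_eqI[where X = H]; simp add: lay_simps mbar_eq)
  also have "\<dots> = \<langle>0|\<mu> \<cdot> (m \<otimes> m)|0\<rangle> \<cdot> \<langle>1|\<c> H H \<cdot> (\<one>H \<otimes> \<Phi>)|1\<rangle> \<cdot> \<langle>0|\<delta>|2\<rangle> \<cdot> \<langle>2|m|0\<rangle> \<cdot> \<langle>1|\<delta>|1\<rangle>"
    unfolding action_mult by (simp add: lay_simps)
  also have "\<dots> = \<langle>0|\<mu> \<cdot> (m \<otimes> m)|0\<rangle> \<cdot> \<langle>1|(\<Phi> \<otimes> \<one>H) \<cdot> \<c> H H|1\<rangle> \<cdot> \<langle>0|\<delta>|2\<rangle> \<cdot> \<langle>2|m|0\<rangle> \<cdot> \<langle>1|\<delta>|1\<rangle>"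
    using Braid_natural[OF Ident_Hom twist_Hom] algebra_Obj by simp
  also have "\<dots> = \<langle>0|\<mu>|0\<rangle> \<cdot> \<langle>0|m|1\<rangle> \<cdot> \<langle>1|\<Phi>|1\<rangle> \<cdot> \<langle>2|m \<cdot> (\<one>H \<otimes> m)|0\<rangle> \<cdot> \<langle>1|\<c> H H|2\<rangle> \<cdot> \<langle>0|\<delta>|3\<rangle> \<cdot> \<langle>1|\<delta>|1\<rangle>"
    by (simp add: lay_simps)
  also have "\<dots> = \<langle>0|\<mu>|0\<rangle> \<cdot> \<langle>0|m|1\<rangle> \<cdot> \<langle>1|\<Phi>|1\<rangle> \<cdot> \<langle>2|m \<cdot> (mbar \<otimes> \<one>H)|0\<rangle> \<cdot> \<langle>1|\<c> H H|2\<rangle> \<cdot> \<langle>0|\<delta>|3\<rangle> \<cdot> \<langle>1|\<delta>|1\<rangle>"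
    by (simp only: action_action mbar_eq)
  finally show ?thesis
    by (simp add: lay_simps)
qed

lemma twist_mbar: "\<Phi> \<cdot> mbar = \<mu> \<cdot> (\<Phi> \<otimes> m) \<cdot> (\<delta> \<otimes> \<Phi>)"
  using twist_mult by (simp add: mbar_eq)

text \<open>
  \<open>x * (y * z) = \<Phi>(x\<^sub>1)(x\<^sub>2 \<rhd> \<Phi>(y\<^sub>1))((x\<^sub>3 * y\<^sub>2) \<rhd> z) = \<Phi>(x\<^sub>1 * y\<^sub>1)((x\<^sub>2 * y\<^sub>2) \<rhd> z)\<close>; only the last step, to
  \<open>(x * y) * z\<close>, needs that \<open>*\<close> is comultiplicative.
\<close>

lemma mbar_assoc:
  assumes "\<delta> \<cdot> mbar = (mbar \<otimes> mbar) \<cdot> tensor_comult C H \<delta> H \<delta>"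
  shows "mbar \<cdot> (mbar \<otimes> \<one>H) = mbar \<cdot> (\<one>H \<otimes> mbar)"
proof -
  have "mbar \<cdot> (\<one>H \<otimes> mbar) = \<langle>0|\<mu>|0\<rangle> \<cdot> \<langle>0|\<Phi>|1\<rangle> \<cdot> \<langle>1|m \<cdot> (\<one>H \<otimes> mbar)|0\<rangle> \<cdot> \<langle>0|\<delta>|2\<rangle>"
    by (subst mbar_eq, rule layer_eqI[where X = H]; simp add: lay_simps)
  also have "\<dots> = \<langle>0|\<mu> \<cdot> (\<one>H \<otimes> \<mu>)|0\<rangle> \<cdot> \<langle>0|\<Phi>|2\<rangle> \<cdot> \<langle>1|m|1\<rangle> \<cdot> \<langle>2|\<Phi>|1\<rangle> \<cdot> \<langle>3|m|0\<rangle> \<cdot> \<langle>3|mbar|1\<rangle>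
      \<cdot> \<langle>2|\<c> H H|2\<rangle> \<cdot> \<langle>3|\<delta>|1\<rangle> \<cdot> \<langle>0|(\<one>H \<otimes> \<delta>) \<cdot> \<delta>|2\<rangle>"
    unfolding action_mbar by (simp add: lay_simps)
  also have "\<dots> = \<langle>0|\<mu> \<cdot> (\<mu> \<otimes> \<one>H)|0\<rangle> \<cdot> \<langle>0|\<Phi>|2\<rangle> \<cdot> \<langle>1|m|1\<rangle> \<cdot> \<langle>2|\<Phi>|1\<rangle> \<cdot> \<langle>3|m|0\<rangle> \<cdot> \<langle>3|mbar|1\<rangle>
      \<cdot> \<langle>2|\<c> H H|2\<rangle> \<cdot> \<langle>3|\<delta>|1\<rangle> \<cdot> \<langle>0|(\<delta> \<otimes> \<one>H) \<cdot> \<delta>|2\<rangle>"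
    by (simp only: mult_assoc comult_coassoc)
  also have "\<dots> = \<langle>0|\<mu>|0\<rangle> \<cdot> \<langle>0|\<mu> \<cdot> (\<Phi> \<otimes> m) \<cdot> (\<delta> \<otimes> \<Phi>)|1\<rangle> \<cdot> \<langle>2|m|0\<rangle> \<cdot> \<langle>2|mbar|1\<rangle>
      \<cdot> \<langle>1|\<c> H H|2\<rangle> \<cdot> \<langle>0|\<delta>|3\<rangle> \<cdot> \<langle>1|\<delta>|1\<rangle>"
    by (simp add: lay_simps)
  also have "\<dots> = \<langle>0|\<mu>|0\<rangle> \<cdot> \<langle>0|\<Phi> \<cdot> mbar|1\<rangle> \<cdot> \<langle>2|m|0\<rangle> \<cdot> \<langle>2|mbar|1\<rangle>
      \<cdot> \<langle>1|\<c> H H|2\<rangle> \<cdot> \<langle>0|\<delta>|3\<rangle> \<cdot> \<langle>1|\<delta>|1\<rangle>"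
    by (simp only: twist_mbar)
  also have "\<dots> = \<langle>0|\<mu>|0\<rangle> \<cdot> \<langle>0|\<Phi>|1\<rangle> \<cdot> \<langle>1|m|0\<rangle> \<cdot> \<langle>0|(mbar \<otimes> mbar) \<cdot> tensor_comult C H \<delta> H \<delta>|1\<rangle>"
    by (simp add: lay_simps tensor_comult_def)
  also have "\<dots> = \<langle>0|\<mu>|0\<rangle> \<cdot> \<langle>0|\<Phi>|1\<rangle> \<cdot> \<langle>1|m|0\<rangle> \<cdot> \<langle>0|\<delta> \<cdot> mbar|1\<rangle>"
    by (simp only: assms)
  also have "\<dots> = mbar \<cdot> (mbar \<otimes> \<one>H)"
    by (subst (2) mbar_eq, rule layer_eqI[where X = H]; simp add: lay_simps)
  finally show ?thesis ..
qed

lemma counit_mbar: "\<epsilon> \<cdot> mbar = \<epsilon> \<otimes> \<epsilon>"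
proof -
  have \<epsilon>: "\<epsilon> \<cdot> \<mu> = \<epsilon> \<otimes> \<epsilon>" "\<epsilon> \<cdot> m = \<epsilon> \<otimes> \<epsilon>" "\<epsilon> \<cdot> \<Phi> = \<epsilon>"
    using mult_coalgebra_morphism action_coalgebra_morphism twist_coalgebra_morphism
    by (auto simp: coalgebra_morphism_def)
  have "\<epsilon> \<cdot> mbar = \<langle>0|\<epsilon> \<cdot> \<mu>|0\<rangle> \<cdot> \<langle>0|\<Phi>|1\<rangle> \<cdot> \<langle>1|m|0\<rangle> \<cdot> \<langle>0|\<delta>|1\<rangle>"
    by (rule layer_eqI[where X = H]; simp add: lay_simps mbar_eq)
  also have "\<dots> = \<langle>0|\<epsilon> \<cdot> \<Phi>|0\<rangle> \<cdot> \<langle>1|\<epsilon> \<cdot> m|0\<rangle> \<cdot> \<langle>0|\<delta>|1\<rangle>"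
    unfolding \<epsilon>(1) by (simp add: lay_simps)
  also have "\<dots> = \<langle>0|\<epsilon>|0\<rangle> \<cdot> \<langle>0|(\<one>H \<otimes> \<epsilon>) \<cdot> \<delta>|0\<rangle> \<cdot> \<langle>1|\<epsilon>|0\<rangle>"
    unfolding \<epsilon> by (simp add: lay_simps)
  also have "\<dots> = \<epsilon> \<otimes> \<epsilon>"
    unfolding comult_counit_right by (rule layer_eqI[where X = H]; simp add: lay_simps)
  finally show ?thesis .
qed

text \<open>
  The hypothesis is a cocommutativity condition: \<open>x\<^sub>2 \<rhd> y \<otimes> x\<^sub>1 = x\<^sub>1 \<rhd> y \<otimes> x\<^sub>2\<close>, with the appropriate
  braidings.
\<close>

lemma comult_mbar:
  assumes cond: "(m \<otimes> \<one>H) \<cdot> (\<one>H \<otimes> \<c> H H) \<cdot> ((\<c> H H \<cdot> \<delta>) \<otimes> \<one>H)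
       = (m \<otimes> \<one>H) \<cdot> (\<one>H \<otimes> \<c> H H) \<cdot> (\<delta> \<otimes> \<one>H)"
  shows "\<delta> \<cdot> mbar = (mbar \<otimes> mbar) \<cdot> tensor_comult C H \<delta> H \<delta>"
proof -
  \<comment> \<open>Both braid identities combine naturality of the braiding with a hexagon.\<close>
  have braid1: "\<c> H H \<cdot> (\<Phi> \<otimes> m) = (m \<otimes> \<Phi>) \<cdot> (\<one>H \<otimes> \<c> H H) \<cdot> (\<c> H H \<otimes> \<one>H)"
    using Braid_natural[OF twist_Hom action_Hom] hexagon_right[of H H H] algebra_Obj by simp
  have braid2: "(\<c> H H \<otimes> \<one>H) \<cdot> (\<one>H \<otimes> \<c> H H) \<cdot> (\<delta> \<otimes> \<one>H) = (\<one>H \<otimes> \<delta>) \<cdot> \<c> H H"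
  proof -
    have "(\<c> H H \<otimes> \<one>H) \<cdot> (\<one>H \<otimes> \<c> H H) \<cdot> (\<delta> \<otimes> \<one>H) = \<c> (H \<odot> H) H \<cdot> (\<delta> \<otimes> \<one>H)"
      using algebra_Obj by (simp add: hexagon_left lay_simps)
    also have "\<dots> = (\<one>H \<otimes> \<delta>) \<cdot> \<c> H H"
      using Braid_natural[OF comult_Hom Ident_Hom] algebra_Obj by simp
    finally show ?thesis .
  qed
  have "\<delta> \<cdot> mbar = \<langle>0|\<delta> \<cdot> \<mu>|0\<rangle> \<cdot> \<langle>0|\<Phi>|1\<rangle> \<cdot> \<langle>1|m|0\<rangle> \<cdot> \<langle>0|\<delta>|1\<rangle>"
    by (rule layer_eqI[where X = H]; simp add: lay_simps mbar_eq)
  also have "\<dots> = \<langle>0|\<mu> \<otimes> \<mu>|0\<rangle> \<cdot> \<langle>1|\<c> H H|1\<rangle> \<cdot> \<langle>0|\<delta> \<cdot> \<Phi>|2\<rangle> \<cdot> \<langle>1|\<delta> \<cdot> m|0\<rangle> \<cdot> \<langle>0|\<delta>|1\<rangle>"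
    unfolding comult_mult by (simp add: lay_simps)
  also have "\<dots> = \<langle>0|\<mu> \<otimes> \<mu>|0\<rangle> \<cdot> \<langle>0|\<Phi>|3\<rangle> \<cdot> \<langle>1|\<c> H H \<cdot> (\<Phi> \<otimes> m)|1\<rangle> \<cdot> \<langle>4|m|0\<rangle> \<cdot> \<langle>3|\<c> H H|1\<rangle>
      \<cdot> \<langle>4|\<delta>|0\<rangle> \<cdot> \<langle>2|\<delta>|1\<rangle> \<cdot> \<langle>0|(\<delta> \<otimes> \<one>H) \<cdot> \<delta>|1\<rangle>"
    unfolding comult_action comult_twist by (simp add: lay_simps)
  also have "\<dots> = \<langle>0|\<mu> \<otimes> \<mu>|0\<rangle> \<cdot> \<langle>0|\<Phi>|3\<rangle> \<cdot> \<langle>1|m \<otimes> \<Phi>|1\<rangle> \<cdot> \<langle>2|\<c> H H|1\<rangle> \<cdot> \<langle>1|\<c> H H|2\<rangle> \<cdot> \<langle>4|m|0\<rangle> \<cdot> \<langle>3|\<c> H H|1\<rangle>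
      \<cdot> \<langle>4|\<delta>|0\<rangle> \<cdot> \<langle>1|(\<one>H \<otimes> \<delta>) \<cdot> \<delta>|1\<rangle> \<cdot> \<langle>0|\<delta>|1\<rangle>"
    unfolding braid1 comult_coassoc by (simp add: lay_simps)
  also have "\<dots> = \<langle>0|\<mu> \<otimes> \<mu>|0\<rangle> \<cdot> \<langle>0|\<Phi>|3\<rangle> \<cdot> \<langle>2|\<Phi>|1\<rangle> \<cdot> \<langle>3|m|0\<rangle>
      \<cdot> \<langle>1|(m \<otimes> \<one>H) \<cdot> (\<one>H \<otimes> \<c> H H) \<cdot> ((\<c> H H \<cdot> \<delta>) \<otimes> \<one>H)|2\<rangle>
      \<cdot> \<langle>2|\<c> H H|1\<rangle> \<cdot> \<langle>3|\<delta>|0\<rangle> \<cdot> \<langle>1|\<delta>|1\<rangle> \<cdot> \<langle>0|\<delta>|1\<rangle>"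
    unfolding comult_coassoc[symmetric] by (simp add: lay_simps)
  also have "\<dots> = \<langle>0|\<mu> \<otimes> \<mu>|0\<rangle> \<cdot> \<langle>0|\<Phi>|3\<rangle> \<cdot> \<langle>2|\<Phi>|1\<rangle> \<cdot> \<langle>3|m|0\<rangle>
      \<cdot> \<langle>1|m|3\<rangle> \<cdot> \<langle>2|\<c> H H|2\<rangle> \<cdot> \<langle>3|\<c> H H|1\<rangle> \<cdot> \<langle>4|\<delta>|0\<rangle> \<cdot> \<langle>1|(\<delta> \<otimes> \<one>H) \<cdot> \<delta>|1\<rangle> \<cdot> \<langle>0|\<delta>|1\<rangle>"
    \<comment> \<open>Coassociativity has brought legs 2 and 3 together, so that \<open>cond\<close> removes their crossing.\<close>
    unfolding cond by (simp add: lay_simps)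
  also have "\<dots> = \<langle>0|\<mu> \<otimes> \<mu>|0\<rangle> \<cdot> \<langle>0|\<Phi>|3\<rangle> \<cdot> \<langle>2|\<Phi>|1\<rangle> \<cdot> \<langle>3|m|0\<rangle>
      \<cdot> \<langle>1|m|3\<rangle> \<cdot> \<langle>2|\<c> H H|2\<rangle> \<cdot> \<langle>3|\<c> H H|1\<rangle> \<cdot> \<langle>4|\<delta>|0\<rangle> \<cdot> \<langle>2|\<delta>|1\<rangle> \<cdot> \<langle>0|(\<one>H \<otimes> \<delta>) \<cdot> \<delta>|1\<rangle>"
    unfolding comult_coassoc by (simp add: lay_simps)
  also have "\<dots> = \<langle>0|\<mu> \<otimes> \<mu>|0\<rangle> \<cdot> \<langle>0|\<Phi>|3\<rangle> \<cdot> \<langle>2|\<Phi>|1\<rangle> \<cdot> \<langle>3|m|0\<rangle> \<cdot> \<langle>1|m|3\<rangle>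
      \<cdot> \<langle>2|(\<c> H H \<otimes> \<one>H) \<cdot> (\<one>H \<otimes> \<c> H H) \<cdot> (\<delta> \<otimes> \<one>H)|1\<rangle> \<cdot> \<langle>3|\<delta>|0\<rangle> \<cdot> \<langle>0|\<delta>|2\<rangle> \<cdot> \<langle>0|\<delta>|1\<rangle>"
    unfolding comult_coassoc[symmetric] by (simp add: lay_simps)
  also have "\<dots> = (mbar \<otimes> mbar) \<cdot> tensor_comult C H \<delta> H \<delta>"
    unfolding braid2 by (rule layer_eqI[where X = H]; simp add: lay_simps tensor_comult_def;
        simp add: lay_simps mbar_eq)
  finally show ?thesis .
qed

text \<open>\<open>x \<rhd> 1 = \<epsilon>(x)1\<close>, by \<open>convolution_idempotent_trivial\<close> for \<open>u = (x \<mapsto> x \<rhd> 1)\<close>.\<close>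

lemma action_unit: "m \<cdot> (\<one>H \<otimes> \<eta>) = \<eta> \<cdot> \<epsilon>"
proof -
  define u where "u = m \<cdot> (\<one>H \<otimes> \<eta>)"
  have u_Hom: "u \<in> Hom C H H"
    using TensorA_Hom[OF Ident_Hom unit_Hom] algebra_Obj action_Hom Comp_Hom
    unfolding u_def by (metis TensorO_Unit_right)
  have u_gen: "u \<in> Hom C (tpow H 1) (tpow H 1)"
    using u_Hom by (simp add: tpow_1)
  note simps2 = lay_simps u_gen[unfolded Hom_iff] layer_Hom[OF algebra_Obj u_gen, unfolded Hom_iff]
    Hom_Into[OF u_gen] layer_Into[OF algebra_Obj u_gen]
    tensor_eq_layers[OF algebra_Obj u_gen u_gen]
  have \<epsilon>m: "\<epsilon> \<cdot> m = \<epsilon> \<otimes> \<epsilon>" and \<epsilon>\<eta>: "\<epsilon> \<cdot> \<eta> = \<one>\<K>" and \<delta>\<eta>: "\<delta> \<cdot> \<eta> = \<eta> \<otimes> \<eta>"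
    using action_coalgebra_morphism unit_coalgebra_morphism
      Comp_Ident_right[OF TensorA_Hom[OF unit_Hom unit_Hom]]
    by (auto simp: coalgebra_morphism_def TensorO_Unit_left Unit_Obj)
  have c\<eta>: "\<c> H H \<cdot> (\<one>H \<otimes> \<eta>) = \<eta> \<otimes> \<one>H"
    using Braid_natural[OF Ident_Hom[OF algebra_Obj] unit_Hom]
      Comp_Ident_right[OF TensorA_Hom[OF unit_Hom Ident_Hom[OF algebra_Obj]]]
    by (simp add: Braid_unit algebra_Obj TensorO_Unit_left)
  have \<epsilon>u: "\<epsilon> \<cdot> u = \<epsilon>"
  proof -
    have "\<epsilon> \<cdot> u = \<langle>0|\<epsilon> \<cdot> m|0\<rangle> \<cdot> \<langle>1|\<eta>|0\<rangle>"
      by (rule layer_eqI[where X = H]; simp add: lay_simps u_def)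
    also have "\<dots> = \<langle>0|\<epsilon>|0\<rangle> \<cdot> \<langle>1|\<epsilon> \<cdot> \<eta>|0\<rangle>"
      unfolding \<epsilon>m by (simp add: lay_simps)
    also have "\<dots> = \<epsilon>"
    proof -
      have "\<langle>1|\<one>\<K>|0\<rangle> = \<one>H"
        using layer_Ident[OF algebra_Obj, of 1 0 0] by (simp add: tpow_1 tpow.simps(1))
      then show ?thesis
        unfolding \<epsilon>\<eta> using counit_Hom by (simp add: layer_0 Hom_def)
    qed
    finally show ?thesis .
  qed
  have \<delta>u: "\<delta> \<cdot> u = (u \<otimes> u) \<cdot> \<delta>"
  proof -
    have "\<delta> \<cdot> u = \<langle>0|\<delta> \<cdot> m|0\<rangle> \<cdot> \<langle>1|\<eta>|0\<rangle>"
      by (rule layer_eqI[where X = H]; simp add: lay_simps u_def)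
    also have "\<dots> = \<langle>0|m \<otimes> m|0\<rangle> \<cdot> \<langle>1|\<c> H H|1\<rangle> \<cdot> \<langle>2|\<delta> \<cdot> \<eta>|0\<rangle> \<cdot> \<langle>0|\<delta>|0\<rangle>"
      unfolding comult_action by (simp add: lay_simps)
    also have "\<dots> = \<langle>0|m \<otimes> m|0\<rangle> \<cdot> \<langle>1|\<c> H H \<cdot> (\<one>H \<otimes> \<eta>)|1\<rangle> \<cdot> \<langle>2|\<eta>|0\<rangle> \<cdot> \<langle>0|\<delta>|0\<rangle>"
      unfolding \<delta>\<eta> by (simp add: lay_simps)
    also have "\<dots> = (u \<otimes> u) \<cdot> \<delta>"
      unfolding c\<eta> by (rule layer_eqI[where X = H]; simp add: simps2; simp add: lay_simps u_def)
    finally show ?thesis .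
  qed
  have idem: "\<mu> \<cdot> (u \<otimes> u) \<cdot> \<delta> = u"
  proof -
    have "u = m \<cdot> (\<one>H \<otimes> ((\<mu> \<cdot> (\<eta> \<otimes> \<one>H)) \<cdot> \<eta>))"
      unfolding mult_unit_left using unit_Hom by (simp add: u_def Hom_def)
    also have "\<dots> = \<langle>0|m \<cdot> (\<one>H \<otimes> \<mu>)|0\<rangle> \<cdot> \<langle>1|\<eta>|1\<rangle> \<cdot> \<langle>1|\<eta>|0\<rangle>"
      by (rule layer_eqI[where X = H]; simp add: lay_simps)
    also have "\<dots> = \<langle>0|\<mu> \<cdot> (m \<otimes> m)|0\<rangle> \<cdot> \<langle>1|\<c> H H \<cdot> (\<one>H \<otimes> \<eta>)|1\<rangle> \<cdot> \<langle>2|\<eta>|0\<rangle> \<cdot> \<langle>0|\<delta>|0\<rangle>"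
      unfolding action_mult by (simp add: lay_simps)
    also have "\<dots> = \<mu> \<cdot> (u \<otimes> u) \<cdot> \<delta>"
      unfolding c\<eta> by (rule layer_eqI[where X = H]; simp add: simps2; simp add: lay_simps u_def)
    finally show ?thesis ..
  qed
  show ?thesis
    using convolution_idempotent_trivial[OF _ idem] u_Hom \<epsilon>u \<delta>u
    by (simp add: coalgebra_morphism_def u_def)
qed


lemma mbar_unit_right: "mbar \<cdot> (\<one>H \<otimes> \<eta>) = \<Phi>"
proof -
  have "mbar \<cdot> (\<one>H \<otimes> \<eta>) = \<langle>0|\<mu>|0\<rangle> \<cdot> \<langle>0|\<Phi>|1\<rangle> \<cdot> \<langle>1|m \<cdot> (\<one>H \<otimes> \<eta>)|0\<rangle> \<cdot> \<langle>0|\<delta>|0\<rangle>"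
    by (rule layer_eqI[where X = H]; simp add: lay_simps mbar_eq)
  also have "\<dots> = \<langle>0|\<mu> \<cdot> (\<one>H \<otimes> \<eta>)|0\<rangle> \<cdot> \<langle>0|\<Phi>|0\<rangle> \<cdot> \<langle>0|(\<one>H \<otimes> \<epsilon>) \<cdot> \<delta>|0\<rangle>"
    unfolding action_unit by (simp add: lay_simps)
  also have "\<dots> = \<Phi>"
    unfolding mult_unit_right comult_counit_right
    using twist_Hom by (simp add: layer_0 Hom_def algebra_Obj)
  finally show ?thesis .
qed

text \<open>\<open>1 \<rhd> (1 \<rhd> y) = (1 * 1) \<rhd> y = \<Phi>(1) \<rhd> y = 1 \<rhd> y\<close>\<close>

lemma unit_action_idem:
  assumes "\<Phi> \<cdot> \<eta> = \<eta>"
  shows "(m \<cdot> (\<eta> \<otimes> \<one>H)) \<cdot> (m \<cdot> (\<eta> \<otimes> \<one>H)) = m \<cdot> (\<eta> \<otimes> \<one>H)"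
proof -
  have "(m \<cdot> (\<eta> \<otimes> \<one>H)) \<cdot> (m \<cdot> (\<eta> \<otimes> \<one>H)) = \<langle>0|m \<cdot> (\<one>H \<otimes> m)|0\<rangle> \<cdot> \<langle>0|\<eta>|2\<rangle> \<cdot> \<langle>0|\<eta>|1\<rangle>"
    by (rule layer_eqI[where X = H]; simp add: lay_simps)
  also have "\<dots> = \<langle>0|m \<cdot> (mbar \<otimes> \<one>H)|0\<rangle> \<cdot> \<langle>0|\<eta>|2\<rangle> \<cdot> \<langle>0|\<eta>|1\<rangle>"
    by (simp only: action_action mbar_eq)
  also have "\<dots> = \<langle>0|m|0\<rangle> \<cdot> \<langle>0|mbar \<cdot> (\<one>H \<otimes> \<eta>)|1\<rangle> \<cdot> \<langle>0|\<eta>|1\<rangle>"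
    by (simp add: lay_simps)
  also have "\<dots> = \<langle>0|m|0\<rangle> \<cdot> \<langle>0|\<Phi> \<cdot> \<eta>|1\<rangle>"
    unfolding mbar_unit_right by (simp add: lay_simps)
  also have "\<dots> = m \<cdot> (\<eta> \<otimes> \<one>H)"
    unfolding assms by (rule layer_eqI[where X = H]; simp add: lay_simps)
  finally show ?thesis .
qed

lemma mbar_unit_left:
  assumes "\<Phi> \<cdot> \<eta> = \<eta>" "m \<cdot> (\<eta> \<otimes> \<one>H) = \<one>H"
  shows "mbar \<cdot> (\<eta> \<otimes> \<one>H) = \<one>H"
proof -
  have \<delta>\<eta>: "\<delta> \<cdot> \<eta> = \<eta> \<otimes> \<eta>"
    using unit_coalgebra_morphism Comp_Ident_right[OF TensorA_Hom[OF unit_Hom unit_Hom]]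
    by (auto simp: coalgebra_morphism_def TensorO_Unit_left Unit_Obj)
  have "mbar \<cdot> (\<eta> \<otimes> \<one>H) = \<langle>0|\<mu>|0\<rangle> \<cdot> \<langle>0|\<Phi>|1\<rangle> \<cdot> \<langle>1|m|0\<rangle> \<cdot> \<langle>0|\<delta> \<cdot> \<eta>|1\<rangle>"
    by (rule layer_eqI[where X = H]; simp add: lay_simps mbar_eq)
  also have "\<dots> = \<langle>0|\<mu>|0\<rangle> \<cdot> \<langle>0|\<Phi> \<cdot> \<eta>|1\<rangle> \<cdot> \<langle>0|m \<cdot> (\<eta> \<otimes> \<one>H)|0\<rangle>"
    unfolding \<delta>\<eta> by (simp add: lay_simps)
  also have "\<dots> = \<langle>0|\<mu> \<cdot> (\<eta> \<otimes> \<one>H)|0\<rangle>"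
    unfolding assms by (simp add: lay_simps)
  also have "\<dots> = \<one>H"
    unfolding mult_unit_left by (simp add: layer_0 algebra_Obj)
  finally show ?thesis .
qed

lemma mbar_twist_right: "mbar \<cdot> (\<one>H \<otimes> \<Phi>) = \<Phi> \<cdot> mbar"
  unfolding twist_mbar by (rule layer_eqI[where X = H]; simp add: lay_simps mbar_eq)

lemma mbar_twist_left:
  assumes "mbar \<cdot> (mbar \<otimes> \<one>H) = mbar \<cdot> (\<one>H \<otimes> mbar)" "mbar \<cdot> (\<eta> \<otimes> \<one>H) = \<one>H"
  shows "mbar \<cdot> (\<Phi> \<otimes> \<one>H) = mbar"
proof -
  have "mbar \<cdot> (\<Phi> \<otimes> \<one>H) = mbar \<cdot> ((mbar \<cdot> (\<one>H \<otimes> \<eta>)) \<otimes> \<one>H)"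
    by (simp only: mbar_unit_right)
  also have "\<dots> = \<langle>0|mbar \<cdot> (mbar \<otimes> \<one>H)|0\<rangle> \<cdot> \<langle>1|\<eta>|1\<rangle>"
    by (rule layer_eqI[where X = H]; simp add: lay_simps)
  also have "\<dots> = \<langle>0|mbar|0\<rangle> \<cdot> \<langle>1|mbar \<cdot> (\<eta> \<otimes> \<one>H)|0\<rangle>"
    unfolding assms(1) by (simp add: lay_simps)
  also have "\<dots> = mbar"
    unfolding assms(2) by (rule layer_eqI[where X = H]; simp add: lay_simps)
  finally show ?thesis .
qed

end

section \<open>The action of the unit\<close>

text \<open>By the zigzag identity, \<open>f\<close> is recovered from \<open>(\<one>X' \<otimes> f) \<cdot> a\<close>.\<close>

lemma (in strict_braided_monoidal_category) Ident_if_fixes_coevaluation: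
  assumes dual: "is_dual C X X' a b" and f: "f \<in> Hom C X X" and eq: "(\<one>X' \<otimes> f) \<cdot> a = a"
  shows "f = \<one>X"
proof -
  have a: "a \<in> Hom C \<K> (X' \<odot> X)" and b: "b \<in> Hom C (X \<odot> X') \<K>" and X': "X' \<in> Obj C"
    and ba: "(b \<otimes> \<one>X) \<cdot> (\<one>X \<otimes> a) = \<one>X"
    using dual by (auto simp: is_dual_def)
  have X: "X \<in> Obj C" using f HomD by blast
  note Homs = a b f
  note typing = Homs[unfolded Hom_iff] Homs[THEN Hom_Into] X X' Unit_Obj
    TensorO_assoc TensorO_Unit_left TensorO_Unit_right TensorO_Obj
  have "f = (\<one>\<K> \<otimes> f) \<cdot> ((b \<otimes> \<one>X) \<cdot> (\<one>X \<otimes> a))"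
    unfolding ba by (simp add: typing TensorA_Unit_left)
  also have "\<dots> = (b \<otimes> f) \<cdot> (\<one>X \<otimes> a)"
    by (simp add: typing merge_simps)
  also have "b \<otimes> f = (b \<otimes> \<one>X) \<cdot> (\<one>X \<otimes> \<one>X' \<otimes> f)"
    using interchange_simp[of "\<one>X \<otimes> \<one>X'" b f "\<one>X"]
    by (simp add: typing TensorA_Ident flip: TensorA_assoc)
  also have "((b \<otimes> \<one>X) \<cdot> (\<one>X \<otimes> \<one>X' \<otimes> f)) \<cdot> (\<one>X \<otimes> a) = (b \<otimes> \<one>X) \<cdot> (\<one>X \<otimes> ((\<one>X' \<otimes> f) \<cdot> a))"
    by (simp add: typing merge_simps)
  also have "\<dots> = \<one>X"
    by (simp only: eq ba)
  finally show ?thesis .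
qed

context twisted_post_hopf_algebra
begin

text \<open>
  Let \<open>L\<close> be the map \<open>y \<mapsto> 1 \<rhd> y\<close>. Precomposing with \<open>\<eta>\<close> turns convolution of arrows \<open>H \<rightarrow> H' \<otimes> H\<close> into
  composition, in the opposite order, of the corresponding endomorphisms of \<open>H\<close>. The transposed action becomes \<open>L\<close>, so a
  convolution inverse gives an \<open>M\<close> with \<open>M \<cdot> L = \<one>H\<close>; and \<open>L\<close> is idempotent.
\<close>

lemma unit_action: "m \<cdot> (\<eta> \<otimes> \<one>H) = \<one>H"
proof -
  obtain H' a b \<beta> where dual: "is_dual C H H' a b" and \<beta>: "\<beta> \<in> Hom C H (H' \<odot> H)"
    and inv: "(\<one>H' \<otimes> b \<otimes> \<one>H) \<cdot> (action_transpose C H m H' a \<otimes> \<beta>) \<cdot> \<delta> = \<epsilon> \<otimes> a"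
    using finite_transpose_invertible by (auto simp: convolution_invertible_def)
  have a: "a \<in> Hom C \<K> (H' \<odot> H)" and b: "b \<in> Hom C (H \<odot> H') \<K>" and H': "H' \<in> Obj C"
    using dual by (auto simp: is_dual_def)
  define L where "L = m \<cdot> (\<eta> \<otimes> \<one>H)"
  define \<alpha> where "\<alpha> = action_transpose C H m H' a"
  define g where "g = \<beta> \<cdot> \<eta>"
  define M where "M = (b \<otimes> \<one>H) \<cdot> (\<one>H \<otimes> g)"
  note Homs0 = a b \<beta> action_Hom unit_Hom counit_Hom comult_Hom Braid_Hom[OF algebra_Obj H']
  note typing0 = Homs0[unfolded Hom_iff] Homs0[THEN Hom_Into] algebra_Obj H' Unit_Obj
    TensorO_assoc TensorO_Unit_left TensorO_Unit_right TensorO_Obj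
  have L: "L \<in> Hom C H H" and \<alpha>: "\<alpha> \<in> Hom C H (H' \<odot> H)" and g: "g \<in> Hom C \<K> (H' \<odot> H)"
    by (simp_all add: Hom_iff L_def \<alpha>_def g_def action_transpose_def typing0)
  have M: "M \<in> Hom C H H"
    using g by (simp add: Hom_iff M_def Into_def typing0)
  note Homs = Homs0 L \<alpha> g M
  note typing = Homs[unfolded Hom_iff] Homs[THEN Hom_Into] algebra_Obj H' Unit_Obj
    TensorO_assoc TensorO_Unit_left TensorO_Unit_right TensorO_Obj
  have c\<eta>: "\<c> H H' \<cdot> (\<eta> \<otimes> \<one>H') = \<one>H' \<otimes> \<eta>"
    using Braid_natural[OF unit_Hom Ident_Hom[OF H']]
    by (simp add: Braid_unit typing)
  have \<alpha>\<eta>: "\<alpha> \<cdot> \<eta> = (\<one>H' \<otimes> L) \<cdot> a"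
  proof -
    have "(\<one>H \<otimes> a) \<cdot> \<eta> = (\<eta> \<otimes> \<one>H' \<otimes> \<one>H) \<cdot> a"
      using interchange_simp[of \<eta> "\<one>H" "\<one>\<K>" a] interchange_simp[of "\<one>\<K>" \<eta> a "\<one>(H' \<odot> H)"]
      by (simp add: typing TensorA_Ident TensorA_Unit_left TensorA_Unit_right)
    then have "\<alpha> \<cdot> \<eta> = (\<one>H' \<otimes> m) \<cdot> ((\<c> H H' \<otimes> \<one>H) \<cdot> ((\<eta> \<otimes> \<one>H') \<otimes> \<one>H)) \<cdot> a"
      by (simp add: \<alpha>_def action_transpose_def typing TensorA_assoc Comp_assoc_simp)
    also have "(\<c> H H' \<otimes> \<one>H) \<cdot> ((\<eta> \<otimes> \<one>H') \<otimes> \<one>H) = \<one>H' \<otimes> \<eta> \<otimes> \<one>H"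
      using interchange_simp[of "\<eta> \<otimes> \<one>H'" "\<c> H H'" "\<one>H" "\<one>H"]
      by (simp add: typing c\<eta> TensorA_assoc)
    also have "(\<one>H' \<otimes> m) \<cdot> (\<one>H' \<otimes> \<eta> \<otimes> \<one>H) \<cdot> a = (\<one>H' \<otimes> L) \<cdot> a"
      by (simp add: typing L_def merge_simps)
    finally show ?thesis .
  qed
  have \<delta>\<eta>: "\<delta> \<cdot> \<eta> = \<eta> \<otimes> \<eta>" and \<epsilon>\<eta>: "\<epsilon> \<cdot> \<eta> = \<one>\<K>"
    using unit_coalgebra_morphism Comp_Ident_right[OF TensorA_Hom[OF unit_Hom unit_Hom]]
    by (auto simp: coalgebra_morphism_def TensorO_Unit_left Unit_Obj)
  have "a = (\<epsilon> \<otimes> a) \<cdot> \<eta>"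
    using interchange_simp[of \<eta> \<epsilon> "\<one>\<K>" a]
    by (simp add: typing \<epsilon>\<eta> TensorA_Unit_left TensorA_Unit_right)
  also have "\<dots> = (\<one>H' \<otimes> b \<otimes> \<one>H) \<cdot> (\<alpha> \<otimes> \<beta>) \<cdot> (\<delta> \<cdot> \<eta>)"
    unfolding inv[symmetric] \<alpha>_def[symmetric] by (simp add: typing Comp_assoc_simp)
  also have "(\<alpha> \<otimes> \<beta>) \<cdot> (\<delta> \<cdot> \<eta>) = ((\<one>H' \<otimes> L) \<cdot> a) \<otimes> g"
    unfolding \<delta>\<eta> \<alpha>\<eta>[symmetric] g_def by (simp add: typing interchange_simp)
  also have "\<dots> = (\<one>H' \<otimes> L \<otimes> g) \<cdot> a"
    using interchange_simp[of a "\<one>H' \<otimes> L" "\<one>\<K>" g]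
    by (simp add: typing TensorA_Unit_right TensorA_assoc)
  also have "L \<otimes> g = (\<one>H \<otimes> g) \<cdot> L"
    using interchange_simp[of L "\<one>H" "\<one>\<K>" g] by (simp add: typing TensorA_Unit_right)
  also have "(\<one>H' \<otimes> b \<otimes> \<one>H) \<cdot> (\<one>H' \<otimes> ((\<one>H \<otimes> g) \<cdot> L)) \<cdot> a = (\<one>H' \<otimes> (M \<cdot> L)) \<cdot> a"
    by (simp add: typing M_def merge_simps)
  finally have "M \<cdot> L = \<one>H"
    using Ident_if_fixes_coevaluation[OF dual Comp_Hom[OF L M]] by simp
  moreover have "L \<cdot> L = L"
    unfolding L_def by (rule unit_action_idem[OF twist_unit])
  ultimately have "L = \<one>H"
    using Comp_assoc[OF L L M] Comp_Ident_left[OF L] by simp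
  then show ?thesis
    by (simp add: L_def)
qed

end

section \<open>The bialgebra on the image of the twist\<close>

context twisted_post_hopf_algebra
begin

lemma bialgebra_twist_image:
  assumes cond: "(m \<otimes> \<one>H) \<cdot> (\<one>H \<otimes> \<c> H H) \<cdot> ((\<c> H H \<cdot> \<delta>) \<otimes> \<one>H)
       = (m \<otimes> \<one>H) \<cdot> (\<one>H \<otimes> \<c> H H) \<cdot> (\<delta> \<otimes> \<one>H)"
    and split: "splitting C H \<Phi> I p i"
  shows "bialgebra_in C I (p \<cdot> \<eta>) (p \<cdot> mbar \<cdot> (i \<otimes> i)) (\<epsilon> \<cdot> i) ((p \<otimes> p) \<cdot> \<delta> \<cdot> i)"
proof -
  have p: "p \<in> Hom C H I" and i: "i \<in> Hom C I H" and ip: "i \<cdot> p = \<Phi>" and pi: "p \<cdot> i = \<one>I"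
    using split by (auto simp: splitting_def)
  have I: "I \<in> Obj C" using HomD p by blast
  note coalg = split_coalgebra[OF split twist_coalgebra_morphism]
  define \<delta>\<^sub>I where "\<delta>\<^sub>I = (p \<otimes> p) \<cdot> \<delta> \<cdot> i"
  define \<mu>\<^sub>I where "\<mu>\<^sub>I = p \<cdot> mbar \<cdot> (i \<otimes> i)"
  interpret I: coalgebra_in C I "\<epsilon> \<cdot> i" \<delta>\<^sub>I
    unfolding \<delta>\<^sub>I_def by (rule coalg)
  note Homs = p i twist_Hom mbar_Hom unit_Hom counit_Hom comult_Hom
    Braid_Hom[OF algebra_Obj algebra_Obj] Braid_Hom[OF I I] I.comult_Hom
  note typing = Homs[unfolded Hom_iff] Homs[THEN Hom_Into] algebra_Obj I Unit_Obj
    TensorO_assoc TensorO_Unit_left TensorO_Unit_right TensorO_Obj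
  have p\<Phi>: "p \<cdot> \<Phi> = p"
    using Comp_assoc[OF p i p] p by (simp add: ip pi Hom_iff)
  have \<mu>I: "\<mu>\<^sub>I \<in> Hom C (I \<odot> I) I"
    by (simp add: \<mu>\<^sub>I_def Hom_iff typing)
  note mbar_comult = comult_mbar[OF cond]
  note assoc = mbar_assoc[OF mbar_comult]
  note unit_left = mbar_unit_left[OF twist_unit unit_action]
  have alg: "algebra_in C I (p \<cdot> \<eta>) \<mu>\<^sub>I"
  proof
    have "\<mu>\<^sub>I \<cdot> ((p \<cdot> \<eta>) \<otimes> \<one>I) = p \<cdot> mbar \<cdot> (((i \<cdot> p) \<cdot> \<eta>) \<otimes> i)"
      by (simp add: \<mu>\<^sub>I_def typing merge_simps)
    also have "\<dots> = p \<cdot> (mbar \<cdot> (\<eta> \<otimes> \<one>H)) \<cdot> (\<one>\<K> \<otimes> i)"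
      by (simp add: ip twist_unit typing merge_simps)
    also have "\<dots> = \<one>I"
      by (simp add: unit_left typing TensorA_Unit_left pi)
    finally show "\<mu>\<^sub>I \<cdot> ((p \<cdot> \<eta>) \<otimes> \<one>I) = \<one>I" .
    have "\<mu>\<^sub>I \<cdot> (\<one>I \<otimes> (p \<cdot> \<eta>)) = p \<cdot> mbar \<cdot> (i \<otimes> ((i \<cdot> p) \<cdot> \<eta>))"
      by (simp add: \<mu>\<^sub>I_def typing merge_simps)
    also have "\<dots> = (p \<cdot> (mbar \<cdot> (\<one>H \<otimes> \<eta>))) \<cdot> (i \<otimes> \<one>\<K>)"
      by (simp add: ip twist_unit typing merge_simps)
    also have "\<dots> = \<one>I"
      by (simp add: mbar_unit_right p\<Phi> typing TensorA_Unit_right pi)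
    finally show "\<mu>\<^sub>I \<cdot> (\<one>I \<otimes> (p \<cdot> \<eta>)) = \<one>I" .
    have "\<mu>\<^sub>I \<cdot> (\<mu>\<^sub>I \<otimes> \<one>I) = p \<cdot> mbar \<cdot> (((i \<cdot> p) \<cdot> mbar \<cdot> (i \<otimes> i)) \<otimes> i)"
      by (simp add: \<mu>\<^sub>I_def typing merge_simps)
    also have "\<dots> = p \<cdot> (mbar \<cdot> (\<Phi> \<otimes> \<one>H)) \<cdot> (mbar \<otimes> \<one>H) \<cdot> ((i \<otimes> i) \<otimes> i)"
      by (simp add: ip typing merge_simps)
    also have "\<dots> = p \<cdot> (mbar \<cdot> (mbar \<otimes> \<one>H)) \<cdot> ((i \<otimes> i) \<otimes> i)"
      unfolding mbar_twist_left[OF assoc unit_left] by (simp add: typing Comp_assoc_simp)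
    also have "\<dots> = (p \<cdot> \<Phi>) \<cdot> mbar \<cdot> (\<one>H \<otimes> mbar) \<cdot> (i \<otimes> (i \<otimes> i))"
      unfolding assoc p\<Phi> by (simp add: typing TensorA_assoc Comp_assoc_simp)
    also have "\<dots> = p \<cdot> (\<Phi> \<cdot> mbar) \<cdot> (\<one>H \<otimes> mbar) \<cdot> (i \<otimes> (i \<otimes> i))"
      by (simp add: typing Comp_assoc_simp)
    also have "\<dots> = p \<cdot> mbar \<cdot> (i \<otimes> ((i \<cdot> p) \<cdot> mbar \<cdot> (i \<otimes> i)))"
      unfolding mbar_twist_right[symmetric] ip by (simp add: typing merge_simps)
    also have "\<dots> = \<mu>\<^sub>I \<cdot> (\<one>I \<otimes> \<mu>\<^sub>I)"
      by (simp add: \<mu>\<^sub>I_def typing merge_simps)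
    finally show "\<mu>\<^sub>I \<cdot> (\<mu>\<^sub>I \<otimes> \<one>I) = \<mu>\<^sub>I \<cdot> (\<one>I \<otimes> \<mu>\<^sub>I)" .
  qed (use I \<mu>I in \<open>simp_all add: Hom_iff typing\<close>)
  have t_Hom: "tensor_comult C H \<delta> H \<delta> \<in> Hom C (H \<odot> H) ((H \<odot> H) \<odot> (H \<odot> H))"
    "tensor_comult C I \<delta>\<^sub>I I \<delta>\<^sub>I \<in> Hom C (I \<odot> I) ((I \<odot> I) \<odot> (I \<odot> I))"
    by (simp_all add: tensor_comult_def Hom_iff typing)
  have mbar_coalg: "coalgebra_morphism C (H \<odot> H) (\<epsilon> \<otimes> \<epsilon>) (tensor_comult C H \<delta> H \<delta>) H \<epsilon> \<delta> mbar"
    by (simp add: coalgebra_morphism_def mbar_Hom counit_mbar mbar_comult)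
  note i_coalg = coalg(2)[folded \<delta>\<^sub>I_def] and p_coalg = coalg(3)[folded \<delta>\<^sub>I_def]
  have "coalgebra_morphism C (I \<odot> I) ((\<epsilon> \<cdot> i) \<otimes> (\<epsilon> \<cdot> i)) (tensor_comult C I \<delta>\<^sub>I I \<delta>\<^sub>I) H \<epsilon> \<delta>
      (mbar \<cdot> (i \<otimes> i))"
    using coalgebra_morphism_comp[OF coalgebra_morphism_tensor[OF i_coalg i_coalg] mbar_coalg]
      counit_Hom comult_Hom I.comult_Hom t_Hom by simp
  then have mult: "coalgebra_morphism C (I \<odot> I) ((\<epsilon> \<cdot> i) \<otimes> (\<epsilon> \<cdot> i)) (tensor_comult C I \<delta>\<^sub>I I \<delta>\<^sub>I)
      I (\<epsilon> \<cdot> i) \<delta>\<^sub>I \<mu>\<^sub>I"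
    unfolding \<mu>\<^sub>I_def
    using coalgebra_morphism_comp[OF _ p_coalg] I.counit_Hom comult_Hom I.comult_Hom t_Hom by simp
  have unit: "coalgebra_morphism C \<K> (\<one>\<K>) (\<one>\<K>) I (\<epsilon> \<cdot> i) \<delta>\<^sub>I (p \<cdot> \<eta>)"
    using coalgebra_morphism_comp[OF unit_coalgebra_morphism p_coalg]
      I.counit_Hom comult_Hom I.comult_Hom Ident_Hom[OF Unit_Obj]
    by (simp add: TensorO_Unit_left Unit_Obj)
  show ?thesis
    unfolding \<mu>\<^sub>I_def[symmetric] \<delta>\<^sub>I_def[symmetric]
    using alg I.coalgebra_in_axioms unit mult
    by (simp add: bialgebra_in_def bialgebra_in_axioms_def)
qed

end

theorem theorem3p21:
  fixes C :: "('o, 'm, 'z) braided_data_scheme" (structure)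
    and H I :: 'o
    and \<eta> \<mu> \<epsilon> \<delta> S m \<Phi> p i :: 'm
  assumes "strict_braided_monoidal_category C"
    and "admits_split_idempotents C"
    and "twisted_post_hopf_algebra C H \<eta> \<mu> \<epsilon> \<delta> S m \<Phi>"
    and "(m \<otimes> \<one>H) \<cdot> (\<one>H \<otimes> \<c> H H) \<cdot> ((\<c> H H \<cdot> \<delta>) \<otimes> \<one>H)
       = (m \<otimes> \<one>H) \<cdot> (\<one>H \<otimes> \<c> H H) \<cdot> (\<delta> \<otimes> \<one>H)"
    and "splitting C H \<Phi> I p i"
  shows "bialgebra_in C I (p \<cdot> \<eta>) (p \<cdot> mult_bar C H \<mu> \<delta> m \<Phi> \<cdot> (i \<otimes> i))
           (\<epsilon> \<cdot> i) ((p \<otimes> p) \<cdot> \<delta> \<cdot> i)"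
proof -
  interpret twisted_post_hopf_algebra C H \<eta> \<mu> \<epsilon> \<delta> S m \<Phi>
    by fact
  show ?thesis
    using assms(4,5) by (rule bialgebra_twist_image)
qed

end
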